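(* Let $(V,\mu)$ be a minimax solution of the first-order mean field game system (in the sense of the context). Assume that $\partial H/\partial p$ exists and that $V$ is differentiable. Then $V$ is a classical solution of the Hamilton--Jacobi equation for $\mu$, i.e. $$\frac{\partial V}{\partial t}(t,x)+H(t,x,\mu[t],\nabla V(t,x))=0\quad\text{at every }(t,x)\in[0,T]\times\mathbb{R}^n,\qquad V(T,\cdot)=\sigma(\cdot,\mu[T]),$$ and $\mu$ satisfies the kinetic equation $\frac{d}{dt}\mu[t]=\mu[t]\langle\frac{\partial H}{\partial p}(t,x,\mu[t],\nabla V),\nabla\rangle$, $\mu[0]=m_0$, in the weak sense, i.e. for all $\phi\in C_b^1(\mathbb{R}^n)$ and $\psi\in C_b^1([0,T])$ with $\psi(0)=\psi(T)=0$ $$-\int_0^T\int_{\mathbb{R}^n}\psi'(t)\phi(x)\,\mu[t](dx)\,dt=\int_0^T\int_{\mathbb{R}^n}\psi(t)\Big\langle\frac{\partial H}{\partial p}(t,x,\mu[t],\nabla V(t,x)),\nabla\phi(x)\Big\rangle\mu[t](dx)\,dt .$$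
   Context: Spaces. $\mathcal{P}(\mathbb{R}^n)$ is the set of Borel probability measures on $\mathbb{R}^n$ with finite first moment, metrized by $W(m',m'')=\sup\{\int\phi\,d(m'-m''):\phi:\mathbb{R}^n\to\mathbb{R}\ \text{1-Lipschitz}\}$. $\mathcal{M}$ is the set of continuous maps $\mu:[0,T]\to\mathcal{P}(\mathbb{R}^n)$, $t\mapsto\mu[t]$ (external fields). $C_b^1$ denotes bounded $C^1$ functions with bounded first derivatives. Data and standing assumptions. $T>0$; $P$ is a nonempty compact metric space; $f:[0,T]\times\mathbb{R}^n\times\mathcal{P}(\mathbb{R}^n)\times P\to\mathbb{R}^n$ and $g:[0,T]\times\mathbb{R}^n\times\mathcal{P}(\mathbb{R}^n)\times P\to\mathbb{R}$ are continuous; there are constants $L_{f,x},L_{f,m}$ with $\|f(t,x',m,u)-f(t,x'',m,u)\|\le L_{f,x}\|x'-x''\|$ and $\|f(t,x,m',u)-f(t,x,m'',u)\|\le L_{f,m}W(m',m'')$; $\sigma:\mathbb{R}^n\times\mathcal{P}(\mathbb{R}^n)\to\mathbb{R}$ is continuous; $m_0\in\mathcal{P}(\mathbb{R}^n)$ has compact support $G_0$. There is a compact set $G\subset\mathbb{R}^n$ such that for every $\mu\in\mathcal{M}$, every measurable $u:[0,T]\to P$ and every solution of $\dot x(t)=f(t,x(t),\mu[t],u(t))$ with $x(0)\in G_0$, one has $x(t)\in G$ for all $t\in[0,T]$. The Hamiltonian is $H(t,x,m,p)=\max_{u\in P}[\langle p,f(t,x,m,u)\rangle-g(t,x,m,u)]$;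 $\partial H/\partial p$ is its gradient in $p$. The mean field game system is $\partial_tV+H(t,x,\mu[t],\nabla V)=0$, $V(T,\cdot)=\sigma(\cdot,\mu[T])$, together with the kinetic equation of the claim. Minimax solutions. Put $E^-(t,x,m)=\mathrm{co}\{(f(t,x,m,u),g(t,x,m,u)):u\in P\}\subset\mathbb{R}^{n+1}$ and $E^+(t,x,m,u)=\{(f(t,x,m,u),g(t,x,m,u))\}$, $u\in P$. A set $D\subset[0,T]\times\mathbb{R}^n\times\mathbb{R}$ is viable under a differential inclusion for $(x,z)$ if for every $(t_0,x_0,z_0)\in D$ there is an absolutely continuous solution on $[t_0,T]$ starting at $(x_0,z_0)$ with $(t,x(t),z(t))\in D$ for all $t\in[t_0,T]$. For given $\mu\in\mathcal{M}$, a continuous $V:[0,T]\times\mathbb{R}^n\to\mathbb{R}$ is a minimax solution of the Hamilton--Jacobi equation if: (i) $V(T,\cdot)=\sigma(\cdot,\mu[T])$; (ii) for every $u\in P$ the epigraph $\{z\ge V(t,x)\}$ is viable under $(\dot x,\dot z)\in E^+(t,x,\mu[t],u)$; (iii) the hypograph $\{z\le V(t,x)\}$ is viable under $(\dot x,\dot z)\in E^-(t,x,\mu[t])$. $\mathcal{S}[V,\mu]$ is the set of absolutely continuous $(x(\cdot),z(\cdot)):[0,T]\to\mathbb{R}^{n+1}$ with $(\dot x(t),\dot z(t))\in E^-(t,x(t),\mu[t])$ for a.e. $t$ and $z(t)=V(t,x(t))$ for all $t$; $e_t(x(\cdot),z(\cdot))=x(t)$. A pair $(V,\mu)\in C([0,T]\times\mathbb{R}^n)\times\mathcal{M}$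 is a minimax solution of the mean field game system if: (1) $V$ is a minimax solution of the Hamilton--Jacobi equation for $\mu$; (2) $\mu[0]=m_0$; (3) there is a Borel (probability) measure $\chi$ on $\mathcal{S}[V,\mu]$ with $\mu[t]=e_t\#\chi$ for all $t\in[0,T]$. *)

theory Defs
  imports "HOL-Probability.Probability"
begin

section \<open>Borel probability measures with finite first moment\<close>

typedef (overloaded) ('a::euclidean_space) prob1 =
  "{m :: 'a measure. prob_space m \<and> sets m = sets borel \<and> integrable m norm}"
  morphisms law Prob1
proof
  have "AE x in return borel (0::'a). norm x = 0"
    by (subst AE_return) auto
  moreover have "integrable (return borel (0::'a)) (\<lambda>x. 0::real)"
    by simp
  ultimately have "integrable (return borel (0::'a)) norm"
    by (subst integrable_cong_AE[where g = "\<lambda>_. 0"]) auto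
  then show "return borel (0::'a) \<in>
      {m. prob_space m \<and> sets m = sets borel \<and> integrable m norm}"
    by (auto intro: prob_space_return)
qed

lemma prob_space_law: "prob_space (law m)"
  and sets_law [simp, measurable_cong]: "sets (law m) = sets borel"
  and integrable_norm_law: "integrable (law m) norm"
  using law[of m] by auto

lemma space_law [simp]: "space (law m) = UNIV"
  using sets_eq_imp_space_eq[OF sets_law[of m]] by simp

lemma integrable_law_lipschitz:
  fixes \<phi> :: "'a::euclidean_space \<Rightarrow> real"
  assumes "L-lipschitz_on UNIV \<phi>"
  shows "integrable (law m) \<phi>"
proof -
  interpret prob_space "law m" by (rule prob_space_law)
  have "continuous_on UNIV \<phi>"
    using assms by (rule lipschitz_on_continuous_on)
  then have [measurable]: "\<phi> \<in> borel_measurable (law m)"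
    by (simp add: borel_measurable_continuous_onI measurable_cong_sets[OF sets_law refl])
  have le: "norm (\<phi> x) \<le> norm (\<bar>\<phi> 0\<bar> + L * norm x)" for x
  proof -
    have "\<bar>\<phi> x - \<phi> 0\<bar> \<le> L * norm x"
      using lipschitz_onD[OF assms, of x 0] by (simp add: dist_real_def)
    then show ?thesis unfolding real_norm_def by linarith
  qed
  have int: "integrable (law m) (\<lambda>x. \<bar>\<phi> 0\<bar> + L * norm x)"
    using integrable_norm_law[of m] by simp
  show ?thesis
    by (rule Bochner_Integration.integrable_bound[OF int]) (measurable, rule AE_I2, rule le)
qed

definition wdist :: "'a::euclidean_space prob1 \<Rightarrow> 'a prob1 \<Rightarrow> real" where
  "wdist m' m'' =
     (SUP \<phi>\<in>{\<phi>. 1-lipschitz_on UNIV \<phi>}. integral\<^sup>L (law m') \<phi> - integral\<^sup>L (law m'') \<phi>)"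

lemma bdd_above_wdist:
  "bdd_above ((\<lambda>\<phi>. integral\<^sup>L (law m') \<phi> - integral\<^sup>L (law m'') \<phi>) `
     {\<phi> :: 'a::euclidean_space \<Rightarrow> real. 1-lipschitz_on UNIV \<phi>})"
proof (rule bdd_aboveI2)
  fix \<phi> :: "'a \<Rightarrow> real" assume "\<phi> \<in> {\<phi>. 1-lipschitz_on UNIV \<phi>}"
  then have lip: "1-lipschitz_on UNIV \<phi>" by simp
  have bnd: "\<bar>integral\<^sup>L (law m) \<phi> - \<phi> 0\<bar> \<le> integral\<^sup>L (law m) norm" for m :: "'a prob1"
  proof -
    interpret prob_space "law m" by (rule prob_space_law)
    have int: "integrable (law m) \<phi>"
      using lip by (rule integrable_law_lipschitz)
    have "integral\<^sup>L (law m) \<phi> - \<phi> 0 = (\<integral>x. \<phi> x - \<phi> 0 \<partial>law m)"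
      using int by (simp add: prob_space[simplified])
    also have "\<bar>\<dots>\<bar> \<le> (\<integral>x. \<bar>\<phi> x - \<phi> 0\<bar> \<partial>law m)"
      by (rule integral_abs_bound)
    also have "\<dots> \<le> integral\<^sup>L (law m) norm"
      using lipschitz_onD[OF lip, of _ 0] int integrable_norm_law[of m]
      by (intro integral_mono) (auto simp: dist_real_def)
    finally show ?thesis .
  qed
  show "integral\<^sup>L (law m') \<phi> - integral\<^sup>L (law m'') \<phi>
      \<le> integral\<^sup>L (law m') norm + integral\<^sup>L (law m'') norm"
    using bnd[of m'] bnd[of m''] by linarith
qed

lemma wdist_upper:
  "1-lipschitz_on UNIV \<phi> \<Longrightarrow> integral\<^sup>L (law m') \<phi> - integral\<^sup>L (law m'') \<phi> \<le> wdist m' m''"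
  unfolding wdist_def by (rule cSUP_upper[OF _ bdd_above_wdist]) simp

lemma wdist_least:
  fixes m' m'' :: "'a::euclidean_space prob1"
  assumes "\<And>\<phi> :: 'a \<Rightarrow> real. 1-lipschitz_on UNIV \<phi> \<Longrightarrow>
    integral\<^sup>L (law m') \<phi> - integral\<^sup>L (law m'') \<phi> \<le> b"
  shows "wdist m' m'' \<le> b"
  unfolding wdist_def
proof (rule cSUP_least)
  have "1-lipschitz_on UNIV (\<lambda>_::'a. 0::real)"
    by (auto intro!: lipschitz_onI)
  then show "{\<phi> :: 'a \<Rightarrow> real. 1-lipschitz_on UNIV \<phi>} \<noteq> {}" by blast
qed (use assms in auto)

lemma lipschitz_uminus_real:
  fixes \<phi> :: "'a::euclidean_space \<Rightarrow> real"
  shows "L-lipschitz_on UNIV \<phi> \<Longrightarrow> L-lipschitz_on UNIV (\<lambda>x. - \<phi> x)"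
  unfolding lipschitz_on_def by (simp add: dist_minus)

lemma wdist_refl: "wdist m m = 0"
proof (rule antisym)
  show "wdist m m \<le> 0" by (rule wdist_least) simp
  show "0 \<le> wdist m m"
    using wdist_upper[of "\<lambda>_. 0" m m] by (simp add: lipschitz_on_def)
qed

lemma law_eqI:
  fixes m' m'' :: "'a::euclidean_space prob1"
  assumes eq: "\<And>\<phi> :: 'a \<Rightarrow> real. \<And>L. L-lipschitz_on UNIV \<phi> \<Longrightarrow>
    integral\<^sup>L (law m') \<phi> = integral\<^sup>L (law m'') \<phi>"
  shows "m' = m''"
proof -
  have closed_eq: "measure (law m') C = measure (law m'') C" if C: "closed C" for C :: "'a set"
  proof (cases "C = {}")
    case False
    define \<phi> where "\<phi> k x = max 0 (1 - real k * infdist x C)" for k x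
    have lip: "(real k)-lipschitz_on UNIV (\<phi> k)" for k
    proof (rule lipschitz_onI)
      fix x y :: 'a
      have "\<bar>\<phi> k x - \<phi> k y\<bar> \<le> \<bar>real k * infdist x C - real k * infdist y C\<bar>"
        unfolding \<phi>_def by (auto simp: max_def)
      also have "\<dots> = real k * \<bar>infdist x C - infdist y C\<bar>"
        by (simp add: abs_mult flip: right_diff_distrib)
      also have "\<dots> \<le> real k * dist x y"
        using infdist_triangle_abs[of x C y] by (intro mult_left_mono) auto
      finally show "dist (\<phi> k x) (\<phi> k y) \<le> real k * dist x y"
        by (simp add: dist_real_def)
    qed simp
    have lim: "(\<lambda>k. \<phi> k x) \<longlonglongrightarrow> indicator C x" for x
    proof (cases "x \<in> C")
      case True
      then show ?thesis by (simp add: \<phi>_def)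
    next
      case nin: False
      have pos: "infdist x C > 0"
        using C False nin infdist_pos_not_in_closed by blast
      obtain N :: nat where N: "1 < real N * infdist x C"
        using reals_Archimedean3[OF pos] by blast
      have "eventually (\<lambda>k. \<phi> k x = indicator C x) sequentially"
        using eventually_ge_at_top[of N]
      proof eventually_elim
        case (elim k)
        have "real N * infdist x C \<le> real k * infdist x C"
          using elim pos by (intro mult_right_mono) auto
        with N nin show ?case by (simp add: \<phi>_def)
      qed
      then show ?thesis by (rule tendsto_eventually)
    qed
    have conv: "(\<lambda>k. integral\<^sup>L (law m) (\<phi> k)) \<longlonglongrightarrow> measure (law m) C" for m :: "'a prob1"
    proof -
      interpret prob_space "law m" by (rule prob_space_law)
      have [measurable]: "C \<in> sets borel" using C by simp
      have "(\<lambda>k. integral\<^sup>L (law m) (\<phi> k)) \<longlonglongrightarrow> integral\<^sup>L (law m) (indicator C :: 'a \<Rightarrow> real)"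
      proof (rule integral_dominated_convergence[where w = "\<lambda>_. 1"])
        show "\<phi> k \<in> borel_measurable (law m)" for k
          using integrable_law_lipschitz[OF lip] by (rule borel_measurable_integrable)
        show "AE x in law m. norm (\<phi> k x) \<le> 1" for k
          by (auto simp: \<phi>_def infdist_nonneg)
      qed (use lim in auto)
      then show ?thesis by simp
    qed
    show ?thesis
      using conv[of m'] conv[of m''] eq[OF lip] by (simp add: LIMSEQ_unique)
  qed simp
  have "law m' = law m''"
  proof (rule measure_eqI_generator_eq[where E = "{C. closed C}" and \<Omega> = UNIV and A = "\<lambda>_. UNIV"])
    show "Int_stable {C :: 'a set. closed C}" by (auto simp: Int_stable_def)
    show "sets (law m') = sigma_sets UNIV {C. closed C}"
      "sets (law m'') = sigma_sets UNIV {C. closed C}"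
      by (simp_all add: borel_eq_closed)
    interpret m': prob_space "law m'" by (rule prob_space_law)
    interpret m'': prob_space "law m''" by (rule prob_space_law)
    show "emeasure (law m') C = emeasure (law m'') C" if "C \<in> {C. closed C}" for C
      using closed_eq that by (simp add: m'.emeasure_eq_measure m''.emeasure_eq_measure)
    show "emeasure (law m') UNIV \<noteq> \<infinity>" by simp
  qed auto
  then show ?thesis by (simp add: law_inject)
qed

lemma wdist_eq_0_imp:
  fixes m' m'' :: "'a::euclidean_space prob1"
  assumes "wdist m' m'' = 0"
  shows "m' = m''"
proof (rule law_eqI)
  fix \<phi> :: "'a \<Rightarrow> real" and L assume lip: "L-lipschitz_on UNIV \<phi>"
  have 1: "integral\<^sup>L (law m') \<phi> = integral\<^sup>L (law m'') \<phi>"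
    if "1-lipschitz_on UNIV \<phi>" for \<phi> :: "'a \<Rightarrow> real"
    using wdist_upper[OF that, of m' m''] wdist_upper[OF lipschitz_uminus_real[OF that], of m' m'']
      assms by simp
  define c where "c = L + 1"
  have "c > 0" "L \<le> c" using lipschitz_on_nonneg[OF lip] by (auto simp: c_def)
  have "1-lipschitz_on UNIV (\<lambda>x. \<phi> x / c)"
  proof (rule lipschitz_onI)
    fix x y
    have "\<bar>\<phi> x - \<phi> y\<bar> \<le> L * dist x y"
      using lipschitz_onD[OF lip, of x y] by (simp add: dist_real_def)
    also have "\<dots> \<le> c * dist x y"
      using \<open>L \<le> c\<close> by (intro mult_right_mono) auto
    finally have "\<bar>\<phi> x - \<phi> y\<bar> / c \<le> dist x y"
      using \<open>c > 0\<close> by (simp add: pos_divide_le_eq mult.commute)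
    then show "dist (\<phi> x / c) (\<phi> y / c) \<le> 1 * dist x y"
      using \<open>c > 0\<close> by (simp add: dist_real_def abs_divide flip: diff_divide_distrib)
  qed simp
  from 1[OF this] show "integral\<^sup>L (law m') \<phi> = integral\<^sup>L (law m'') \<phi>"
    using \<open>c > 0\<close> by simp
qed

lemma wdist_commute: "wdist m' m'' = wdist m'' m'"
proof -
  have "wdist m' m'' \<le> wdist m'' m'" for m' m'' :: "'a prob1"
  proof (rule wdist_least)
    fix \<phi> :: "'a \<Rightarrow> real" assume "1-lipschitz_on UNIV \<phi>"
    from wdist_upper[OF lipschitz_uminus_real[OF this], of m'' m']
    show "integral\<^sup>L (law m') \<phi> - integral\<^sup>L (law m'') \<phi> \<le> wdist m'' m'" by simp
  qed
  then show ?thesis by (intro antisym)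
qed

lemma wdist_triangle: "wdist m1 m3 \<le> wdist m1 m2 + wdist m2 m3"
proof (rule wdist_least)
  fix \<phi> :: "'a \<Rightarrow> real" assume "1-lipschitz_on UNIV \<phi>"
  from wdist_upper[OF this, of m1 m2] wdist_upper[OF this, of m2 m3]
  show "integral\<^sup>L (law m1) \<phi> - integral\<^sup>L (law m3) \<phi> \<le> wdist m1 m2 + wdist m2 m3" by simp
qed

instantiation prob1 :: (euclidean_space) metric_space
begin

definition dist_prob1 :: "'a prob1 \<Rightarrow> 'a prob1 \<Rightarrow> real" where
  "dist_prob1 = wdist"

definition uniformity_prob1 :: "('a prob1 \<times> 'a prob1) filter" where
  "uniformity_prob1 = (INF e\<in>{0 <..}. principal {(x, y). dist x y < e})"

definition open_prob1 :: "'a prob1 set \<Rightarrow> bool" where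
  "open_prob1 U = (\<forall>x\<in>U. \<forall>\<^sub>F (x', y) in uniformity. x' = x \<longrightarrow> y \<in> U)"

instance
proof
  fix x y z :: "'a prob1"
  show "dist x y = 0 \<longleftrightarrow> x = y"
    unfolding dist_prob1_def using wdist_refl wdist_eq_0_imp by blast
  show "dist x y \<le> dist x z + dist y z"
    unfolding dist_prob1_def using wdist_triangle[of x y z] wdist_commute[of y z] by simp
qed (auto simp: uniformity_prob1_def open_prob1_def)

end

definition msupport :: "'a::topological_space measure \<Rightarrow> 'a set" where
  "msupport m = {x. \<forall>U. open U \<longrightarrow> x \<in> U \<longrightarrow> emeasure m U > 0}"


section \<open>Absolutely continuous solutions and viability\<close>

text \<open>The pairs in \<open>I\<close> are the endpoints of finitely many non-overlapping subintervals.\<close>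

definition abs_cont_on :: "real \<Rightarrow> real \<Rightarrow> (real \<Rightarrow> 'b::metric_space) \<Rightarrow> bool" where
  "abs_cont_on a b y \<longleftrightarrow>
     (\<forall>\<epsilon>>0. \<exists>\<delta>>0. \<forall>I :: (real \<times> real) set.
        finite I \<longrightarrow> (\<forall>(r, s)\<in>I. a \<le> r \<and> r \<le> s \<and> s \<le> b) \<longrightarrow>
        disjoint_family_on (\<lambda>(r, s). {r<..<s}) I \<longrightarrow>
        (\<Sum>(r, s)\<in>I. s - r) < \<delta> \<longrightarrow> (\<Sum>(r, s)\<in>I. dist (y r) (y s)) < \<epsilon>)"

definition solves_inclusion ::
  "real \<Rightarrow> real \<Rightarrow> (real \<Rightarrow> 'b \<Rightarrow> 'b set) \<Rightarrow> (real \<Rightarrow> 'b::real_normed_vector) \<Rightarrow> bool" where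
  "solves_inclusion a b F y \<longleftrightarrow> abs_cont_on a b y \<and>
     (AE t in lebesgue_on {a..b}.
        \<exists>v\<in>F t (y t). (y has_vector_derivative v) (at t within {a..b}))"

definition viable ::
  "real \<Rightarrow> (real \<times> 'b) set \<Rightarrow> (real \<Rightarrow> 'b \<Rightarrow> 'b::real_normed_vector set) \<Rightarrow> bool" where
  "viable T D F \<longleftrightarrow>
     (\<forall>(t\<^sub>0, y\<^sub>0)\<in>D. \<exists>y. solves_inclusion t\<^sub>0 T F y \<and> y t\<^sub>0 = y\<^sub>0 \<and> (\<forall>t\<in>{t\<^sub>0..T}. (t, y t) \<in> D))"

definition epi :: "real \<Rightarrow> (real \<Rightarrow> 'a \<Rightarrow> real) \<Rightarrow> (real \<times> 'a \<times> real) set" where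
  "epi T V = {(t, x, z). t \<in> {0..T} \<and> z \<ge> V t x}"

definition hypo :: "real \<Rightarrow> (real \<Rightarrow> 'a \<Rightarrow> real) \<Rightarrow> (real \<times> 'a \<times> real) set" where
  "hypo T V = {(t, x, z). t \<in> {0..T} \<and> z \<le> V t x}"


section \<open>Minimax solutions\<close>

type_synonym ('n, 'u, 'b) coeff = "real \<Rightarrow> real^'n \<Rightarrow> (real^'n) prob1 \<Rightarrow> 'u \<Rightarrow> 'b"

definition E_plus ::
  "('n::finite, 'u, real^'n) coeff \<Rightarrow> ('n, 'u, real) coeff \<Rightarrow>
   real \<Rightarrow> real^'n \<Rightarrow> (real^'n) prob1 \<Rightarrow> 'u \<Rightarrow> ((real^'n) \<times> real) set" where
  "E_plus f g t x m u = {(f t x m u, g t x m u)}"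

definition E_minus ::
  "'u set \<Rightarrow> ('n::finite, 'u, real^'n) coeff \<Rightarrow> ('n, 'u, real) coeff \<Rightarrow>
   real \<Rightarrow> real^'n \<Rightarrow> (real^'n) prob1 \<Rightarrow> ((real^'n) \<times> real) set" where
  "E_minus P f g t x m = convex hull ((\<lambda>u. (f t x m u, g t x m u)) ` P)"

text \<open>For nonempty compact \<open>P\<close> and continuous \<open>f\<close>, \<open>g\<close> the supremum is attained.\<close>

definition hamiltonian ::
  "'u set \<Rightarrow> ('n::finite, 'u, real^'n) coeff \<Rightarrow> ('n, 'u, real) coeff \<Rightarrow>
   real \<Rightarrow> real^'n \<Rightarrow> (real^'n) prob1 \<Rightarrow> real^'n \<Rightarrow> real" where
  "hamiltonian P f g t x m p = (SUP u\<in>P. p \<bullet> f t x m u - g t x m u)"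

definition hj_minimax_solution ::
  "real \<Rightarrow> 'u set \<Rightarrow> ('n::finite, 'u, real^'n) coeff \<Rightarrow> ('n, 'u, real) coeff \<Rightarrow>
   (real^'n \<Rightarrow> (real^'n) prob1 \<Rightarrow> real) \<Rightarrow> (real \<Rightarrow> (real^'n) prob1) \<Rightarrow>
   (real \<Rightarrow> real^'n \<Rightarrow> real) \<Rightarrow> bool" where
  "hj_minimax_solution T P f g \<sigma> \<mu> V \<longleftrightarrow>
     continuous_on ({0..T} \<times> UNIV) (\<lambda>(t, x). V t x) \<and>
     (\<forall>x. V T x = \<sigma> x (\<mu> T)) \<and>
     (\<forall>u\<in>P. viable T (epi T V) (\<lambda>t (x, z). E_plus f g t x (\<mu> t) u)) \<and>
     viable T (hypo T V) (\<lambda>t (x, z). E_minus P f g t x (\<mu> t))"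

text \<open>\<open>C([0,T])\<close> with the supremum metric; its elements are \<open>undefined\<close> outside \<open>[0,T]\<close>.\<close>

definition path_metric :: "real \<Rightarrow> (real \<Rightarrow> (real^'n::finite) \<times> real) metric" where
  "path_metric T = cfunspace (top_of_set {0..T}) euclidean_metric"

definition path_borel :: "real \<Rightarrow> (real \<Rightarrow> (real^'n::finite) \<times> real) measure" where
  "path_borel T = sigma (mspace (path_metric T)) {U. openin (mtopology_of (path_metric T)) U}"

definition sol_set ::
  "real \<Rightarrow> 'u set \<Rightarrow> ('n::finite, 'u, real^'n) coeff \<Rightarrow> ('n, 'u, real) coeff \<Rightarrow>
   (real \<Rightarrow> real^'n \<Rightarrow> real) \<Rightarrow> (real \<Rightarrow> (real^'n) prob1) \<Rightarrow>
   (real \<Rightarrow> (real^'n) \<times> real) set" where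
  "sol_set T P f g V \<mu> =
     {y \<in> mspace (path_metric T).
        solves_inclusion 0 T (\<lambda>t (x, z). E_minus P f g t x (\<mu> t)) y \<and>
        (\<forall>t\<in>{0..T}. snd (y t) = V t (fst (y t)))}"

definition mfg_minimax_solution ::
  "real \<Rightarrow> 'u set \<Rightarrow> ('n::finite, 'u, real^'n) coeff \<Rightarrow> ('n, 'u, real) coeff \<Rightarrow>
   (real^'n \<Rightarrow> (real^'n) prob1 \<Rightarrow> real) \<Rightarrow> (real^'n) prob1 \<Rightarrow>
   (real \<Rightarrow> real^'n \<Rightarrow> real) \<Rightarrow> (real \<Rightarrow> (real^'n) prob1) \<Rightarrow> bool" where
  "mfg_minimax_solution T P f g \<sigma> m\<^sub>0 V \<mu> \<longleftrightarrow>
     continuous_on {0..T} \<mu> \<and>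
     hj_minimax_solution T P f g \<sigma> \<mu> V \<and>
     \<mu> 0 = m\<^sub>0 \<and>
     (\<exists>Q. prob_space Q \<and>
          sets Q = sets (restrict_space (path_borel T) (sol_set T P f g V \<mu>)) \<and>
          (\<forall>t\<in>{0..T}. law (\<mu> t) = distr Q borel (\<lambda>y. fst (y t))))"


section \<open>Classical and weak solutions\<close>

definition grad :: "('a::real_inner \<Rightarrow> real) \<Rightarrow> 'a \<Rightarrow> 'a" where
  "grad F x = (THE D. GDERIV F x :> D)"

text \<open>The time derivative is one-sided at \<open>t = 0\<close> and \<open>t = T\<close>.\<close>

definition hj_classical_solution ::
  "real \<Rightarrow> 'u set \<Rightarrow> ('n::finite, 'u, real^'n) coeff \<Rightarrow> ('n, 'u, real) coeff \<Rightarrow>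
   (real^'n \<Rightarrow> (real^'n) prob1 \<Rightarrow> real) \<Rightarrow> (real \<Rightarrow> (real^'n) prob1) \<Rightarrow>
   (real \<Rightarrow> real^'n \<Rightarrow> real) \<Rightarrow> bool" where
  "hj_classical_solution T P f g \<sigma> \<mu> V \<longleftrightarrow>
     (\<forall>t\<in>{0..T}. \<forall>x. \<exists>V\<^sub>t p.
        ((\<lambda>s. V s x) has_real_derivative V\<^sub>t) (at t within {0..T}) \<and>
        (GDERIV (V t) x :> p) \<and>
        V\<^sub>t + hamiltonian P f g t x (\<mu> t) p = 0) \<and>
     (\<forall>x. V T x = \<sigma> x (\<mu> T))"

definition Cb1 :: "('a::real_inner \<Rightarrow> real) \<Rightarrow> bool" where
  "Cb1 \<phi> \<longleftrightarrow> (\<forall>x. \<phi> differentiable (at x)) \<and> continuous_on UNIV (grad \<phi>) \<and>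
     bounded (range \<phi>) \<and> bounded (range (grad \<phi>))"

text \<open>\<open>\<psi>'\<close> is the derivative of \<open>\<psi>\<close>, one-sided at the endpoints.\<close>

definition Cb1_interval :: "real \<Rightarrow> (real \<Rightarrow> real) \<Rightarrow> (real \<Rightarrow> real) \<Rightarrow> bool" where
  "Cb1_interval T \<psi> \<psi>' \<longleftrightarrow>
     (\<forall>t\<in>{0..T}. (\<psi> has_real_derivative \<psi>' t) (at t within {0..T})) \<and>
     continuous_on {0..T} \<psi>' \<and> bounded (\<psi> ` {0..T}) \<and> bounded (\<psi>' ` {0..T})"

text \<open>Weak form of the continuity equation with velocity field \<open>v\<close>. The Bochner integral of a
  non-integrable function is \<open>0\<close>, so the existence of the integrals involving \<open>v\<close> is required
  explicitly; the integrals on the left-hand side always exist if \<open>\<mu>\<close> is continuous.\<close>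

definition kinetic_weak_solution ::
  "real \<Rightarrow> (real \<Rightarrow> real^'n::finite \<Rightarrow> real^'n) \<Rightarrow> (real \<Rightarrow> (real^'n) prob1) \<Rightarrow> bool" where
  "kinetic_weak_solution T v \<mu> \<longleftrightarrow>
     (\<forall>\<phi> \<psi> \<psi>'. Cb1 \<phi> \<longrightarrow> Cb1_interval T \<psi> \<psi>' \<longrightarrow> \<psi> 0 = 0 \<longrightarrow> \<psi> T = 0 \<longrightarrow>
        (\<forall>t\<in>{0..T}. integrable (law (\<mu> t)) (\<lambda>x. \<psi> t * (v t x \<bullet> grad \<phi> x))) \<and>
        set_integrable lborel {0..T} (\<lambda>t. \<integral>x. \<psi> t * (v t x \<bullet> grad \<phi> x) \<partial>law (\<mu> t)) \<and>
        - (LBINT t:{0..T}. (\<integral>x. \<psi>' t * \<phi> x \<partial>law (\<mu> t))) =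
          (LBINT t:{0..T}. (\<integral>x. \<psi> t * (v t x \<bullet> grad \<phi> x) \<partial>law (\<mu> t))))"

end

theory Submission
  imports Defs
begin

text \<open>
  Let \<open>(V, \<mu>)\<close> be a minimax solution and let \<open>a\<close> and \<open>p\<close> be the time derivative and the spatial gradient of \<open>V\<close> at
  a point.

  The Hamilton--Jacobi equation expresses infinitesimally that the hypograph and the epigraph of \<open>V\<close> are
  viable. A trajectory \<open>(x, z)\<close> that starts on the graph of \<open>V\<close> and stays below it satisfies \<open>\<Delta>z \<le> \<Delta>V\<close>; since
  its velocities \<open>(v, w)\<close> lie in \<open>E\<^sup>-\<close>, where \<open>p \<bullet> v - w \<le> H\<close>, it follows that \<open>a + H \<ge> 0\<close>. A trajectory of a constant
  control \<open>u\<close> that stays above the graph gives in the same way \<open>a + p \<bullet> f - g \<le> 0\<close>, and \<open>u\<close> may be chosen as a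
  maximiser of \<open>p \<bullet> f - g\<close>. Both cases are instances of \<open>one_sided_hj_inequality\<close>, combined in \<open>hj_pointwise\<close>.
  The terminal time is included: there one uses trajectories that end, instead of start, at that time.

  For the kinetic equation, consider a trajectory \<open>(x, z)\<close> on the graph of \<open>V\<close> with velocities \<open>(v, w)\<close> in \<open>E\<^sup>-\<close>.
  Differentiating \<open>z(t) = V(t, x(t))\<close> and inserting the Hamilton--Jacobi equation shows \<open>p \<bullet> v - w = H(p)\<close>, while
  \<open>q \<bullet> v - w \<le> H(q)\<close> for all \<open>q\<close>. So \<open>v\<close> is a subgradient of the convex function \<open>H\<close> at \<open>p\<close>, and as \<open>H\<close> is
  differentiable, \<open>v\<close> is its gradient (\<open>optimal_trajectory_velocity\<close>). All trajectories on which the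
  path measure lives therefore follow the vector field of the kinetic equation for almost all times. Integrating
  the derivative of \<open>\<psi>(t) \<phi>(x(t))\<close> first along trajectories and then over the path measure yields
  the weak formulation (\<open>kinetic_equation\<close>).

  The analytic basis is the fundamental theorem of calculus for absolutely continuous functions,
  \<open>abs_cont_on_has_integral\<close>. The exchange of integrals needs joint measurability of the velocity
  field and of the evaluation map, and an integrable bound: gradients of \<open>H\<close> are values of \<open>f\<close>, hence of linear
  growth, and the first moments of \<open>\<mu> t\<close> are bounded.\<close>

section \<open>Absolutely continuous functions\<close>

text \<open>
  Applies to components of \<open>y\<close> and to products of a bounded Lipschitz function of time with a bounded
  Lipschitz function of \<open>y\<close>.\<close>

lemma abs_cont_on_compose_dominated:
  assumes ac: "abs_cont_on a b y"
    and dom: "\<And>r s. a \<le> r \<Longrightarrow> r \<le> s \<Longrightarrow> s \<le> b \<Longrightarrow>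
      dist (w r) (w s) \<le> K * (dist (y r) (y s) + (s - r))"
  shows "abs_cont_on a b w"
  unfolding abs_cont_on_def
proof (intro allI impI)
  fix \<epsilon> :: real assume "\<epsilon> > 0"
  define C where "C = \<bar>K\<bar> + 1"
  have "C > 0" by (simp add: C_def)
  then have "\<epsilon> / (2 * C) > 0" using \<open>\<epsilon> > 0\<close> by simp
  then obtain \<delta> where "\<delta> > 0" and \<delta>: "\<And>I. finite I \<Longrightarrow> (\<forall>(r, s)\<in>I. a \<le> r \<and> r \<le> s \<and> s \<le> b) \<Longrightarrow>
        disjoint_family_on (\<lambda>(r, s). {r<..<s}) I \<Longrightarrow>
        (\<Sum>(r, s)\<in>I. s - r) < \<delta> \<Longrightarrow> (\<Sum>(r, s)\<in>I. dist (y r) (y s)) < \<epsilon> / (2 * C)"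
    using ac unfolding abs_cont_on_def by meson
  show "\<exists>\<delta>>0. \<forall>I. finite I \<longrightarrow> (\<forall>(r, s)\<in>I. a \<le> r \<and> r \<le> s \<and> s \<le> b) \<longrightarrow>
        disjoint_family_on (\<lambda>(r, s). {r<..<s}) I \<longrightarrow>
        (\<Sum>(r, s)\<in>I. s - r) < \<delta> \<longrightarrow> (\<Sum>(r, s)\<in>I. dist (w r) (w s)) < \<epsilon>"
  proof (intro exI[of _ "min \<delta> (\<epsilon> / (2 * C))"] conjI allI impI)
    show "min \<delta> (\<epsilon> / (2 * C)) > 0" using \<open>\<delta> > 0\<close> \<open>C > 0\<close> \<open>\<epsilon> > 0\<close> by simp
    fix I :: "(real \<times> real) set"
    assume I: "finite I" "\<forall>(r, s)\<in>I. a \<le> r \<and> r \<le> s \<and> s \<le> b"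
        "disjoint_family_on (\<lambda>(r, s). {r<..<s}) I" "(\<Sum>(r, s)\<in>I. s - r) < min \<delta> (\<epsilon> / (2 * C))"
    have "(\<Sum>(r, s)\<in>I. dist (w r) (w s)) \<le> (\<Sum>(r, s)\<in>I. C * (dist (y r) (y s) + (s - r)))"
    proof (rule sum_mono, clarsimp)
      fix r s assume "(r, s) \<in> I"
      then have rs: "a \<le> r" "r \<le> s" "s \<le> b" using I(2) by auto
      have "dist (w r) (w s) \<le> K * (dist (y r) (y s) + (s - r))" using rs by (rule dom)
      also have "\<dots> \<le> C * (dist (y r) (y s) + (s - r))"
        using rs by (intro mult_right_mono) (auto simp: C_def)
      finally show "dist (w r) (w s) \<le> C * (dist (y r) (y s) + (s - r))" .
    qed
    also have "\<dots> = C * ((\<Sum>(r, s)\<in>I. dist (y r) (y s)) + (\<Sum>(r, s)\<in>I. s - r))"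
      by (simp add: sum_distrib_left sum.distrib[symmetric] case_prod_unfold)
    also have "\<dots> < C * (\<epsilon> / (2 * C) + \<epsilon> / (2 * C))"
      using \<delta>[of I] I \<open>C > 0\<close> by (intro mult_strict_left_mono add_strict_mono) auto
    also have "\<dots> = \<epsilon>" using \<open>C > 0\<close> by (simp add: field_simps)
    finally show "(\<Sum>(r, s)\<in>I. dist (w r) (w s)) < \<epsilon>" .
  qed
qed

lemma abs_cont_on_subinterval:
  assumes "abs_cont_on a b y" "a \<le> c" "d \<le> b"
  shows "abs_cont_on c d y"
  unfolding abs_cont_on_def
proof (intro allI impI)
  fix \<epsilon> :: real assume "\<epsilon> > 0"
  then obtain \<delta> where "\<delta> > 0" and \<delta>: "\<And>I. finite I \<Longrightarrow> (\<forall>(r, s)\<in>I. a \<le> r \<and> r \<le> s \<and> s \<le> b) \<Longrightarrow>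
        disjoint_family_on (\<lambda>(r, s). {r<..<s}) I \<Longrightarrow>
        (\<Sum>(r, s)\<in>I. s - r) < \<delta> \<Longrightarrow> (\<Sum>(r, s)\<in>I. dist (y r) (y s)) < \<epsilon>"
    using assms(1) unfolding abs_cont_on_def by meson
  show "\<exists>\<delta>>0. \<forall>I. finite I \<longrightarrow> (\<forall>(r, s)\<in>I. c \<le> r \<and> r \<le> s \<and> s \<le> d) \<longrightarrow>
        disjoint_family_on (\<lambda>(r, s). {r<..<s}) I \<longrightarrow>
        (\<Sum>(r, s)\<in>I. s - r) < \<delta> \<longrightarrow> (\<Sum>(r, s)\<in>I. dist (y r) (y s)) < \<epsilon>"
  proof (intro exI[of _ \<delta>] conjI allI impI \<open>\<delta> > 0\<close>)
    fix I :: "(real \<times> real) set"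
    assume I: "finite I" "\<forall>(r, s)\<in>I. c \<le> r \<and> r \<le> s \<and> s \<le> d"
        "disjoint_family_on (\<lambda>(r, s). {r<..<s}) I" "(\<Sum>(r, s)\<in>I. s - r) < \<delta>"
    have "\<forall>(r, s)\<in>I. a \<le> r \<and> r \<le> s \<and> s \<le> b" using I(2) assms(2,3) by fastforce
    then show "(\<Sum>(r, s)\<in>I. dist (y r) (y s)) < \<epsilon>" by (rule \<delta>[OF I(1) _ I(3,4)])
  qed
qed

lemma abs_cont_on_imp_continuous_on:
  assumes "abs_cont_on a b y"
  shows "continuous_on {a..b} y"
  unfolding continuous_on_iff
proof (intro ballI allI impI)
  fix t \<epsilon> :: real assume t: "t \<in> {a..b}" and "\<epsilon> > 0"
  then obtain \<delta> where "\<delta> > 0" and \<delta>: "\<And>I. finite I \<Longrightarrow> (\<forall>(r, s)\<in>I. a \<le> r \<and> r \<le> s \<and> s \<le> b) \<Longrightarrow>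
        disjoint_family_on (\<lambda>(r, s). {r<..<s}) I \<Longrightarrow>
        (\<Sum>(r, s)\<in>I. s - r) < \<delta> \<Longrightarrow> (\<Sum>(r, s)\<in>I. dist (y r) (y s)) < \<epsilon>"
    using assms(1) unfolding abs_cont_on_def by meson
  show "\<exists>d>0. \<forall>s\<in>{a..b}. dist s t < d \<longrightarrow> dist (y s) (y t) < \<epsilon>"
  proof (intro exI[of _ \<delta>] conjI ballI impI \<open>\<delta> > 0\<close>)
    fix s assume s: "s \<in> {a..b}" "dist s t < \<delta>"
    show "dist (y s) (y t) < \<epsilon>"
      using \<delta>[of "{(min s t, max s t)}"] s t
      by (cases "s \<le> t") (auto simp: disjoint_family_on_def dist_real_def dist_commute max_def min_def)
  qed
qed

text \<open>
  Fundamental theorem of calculus for absolutely continuous functions, for the gauge integral.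
  The null set \<open>N\<close> is covered by an open set \<open>U\<close> of measure below the \<open>\<delta>\<close> of absolute continuity. The gauge
  forces intervals tagged in \<open>N\<close> into \<open>U\<close>, so that the total increment of \<open>y\<close> over them is small;
  over every other interval the increment of \<open>y\<close> is close to the value of the derivative at the tag
  times the length.\<close>

lemma abs_cont_on_has_integral:
  fixes y :: "real \<Rightarrow> 'b::banach"
  assumes ac: "abs_cont_on a b y" and "a \<le> b" and N: "negligible N"
    and der: "\<And>t. t \<in> {a..b} - N \<Longrightarrow> (y has_vector_derivative y' t) (at t within {a..b})"
  shows "(y' has_integral (y b - y a)) {a..b}"
proof -
  \<comment> \<open>With value \<open>0\<close> on \<open>N\<close>, intervals tagged in \<open>N\<close> do not enter the Riemann sum.\<close>
  define v where "v t = (if t \<in> N then 0 else y' t)" for t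
  have "(v has_integral (y b - y a)) {a..b}"
    unfolding has_integral_real
  proof (intro allI impI)
    fix \<epsilon> :: real assume "\<epsilon> > 0"
    define \<eta> where "\<eta> = \<epsilon> / (2 * (b - a + 1))"
    have "\<eta> > 0" using \<open>\<epsilon> > 0\<close> \<open>a \<le> b\<close> by (simp add: \<eta>_def)
    have "\<epsilon> / 2 > 0" using \<open>\<epsilon> > 0\<close> by simp
    then obtain \<delta> where "\<delta> > 0" and \<delta>: "\<And>I. finite I \<Longrightarrow> (\<forall>(r, s)\<in>I. a \<le> r \<and> r \<le> s \<and> s \<le> b) \<Longrightarrow>
        disjoint_family_on (\<lambda>(r, s). {r<..<s}) I \<Longrightarrow>
        (\<Sum>(r, s)\<in>I. s - r) < \<delta> \<Longrightarrow> (\<Sum>(r, s)\<in>I. dist (y r) (y s)) < \<epsilon> / 2"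
      using ac unfolding abs_cont_on_def by meson
    have "N \<in> sets lebesgue" "N \<in> null_sets lebesgue"
      using N by (auto simp: negligible_iff_null_sets)
    then obtain U where U: "open U" "N \<subseteq> U" "U - N \<in> lmeasurable" "emeasure lebesgue (U - N) < ennreal \<delta>"
      using sets_lebesgue_outer_open \<open>\<delta> > 0\<close> by metis
    have Ulm: "U \<in> lmeasurable" "measure lebesgue U < \<delta>"
    proof -
      have eq: "U = (U - N) \<union> N" using U(2) by auto
      show "U \<in> lmeasurable"
        using U(3) \<open>N \<in> null_sets lebesgue\<close> eq by (metis fmeasurable.Un fmeasurableI_null_sets)
      have "emeasure lebesgue U = emeasure lebesgue (U - N)"
        using \<open>N \<in> null_sets lebesgue\<close> \<open>U \<in> lmeasurable\<close> by (simp add: emeasure_Diff_null_set fmeasurableD)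
      then show "measure lebesgue U < \<delta>"
        using U(4) \<open>U \<in> lmeasurable\<close> \<open>\<delta> > 0\<close>
        by (metis emeasure_eq_measure2 ennreal_less_iff measure_nonneg)
    qed
    have "\<exists>d>0. \<forall>s\<in>{a..b}. \<bar>s - t\<bar> < d \<longrightarrow> norm (y s - y t - (s - t) *\<^sub>R y' t) \<le> \<eta> * \<bar>s - t\<bar>"
      if "t \<in> {a..b} - N" for t
      using der[OF that] \<open>\<eta> > 0\<close>
      unfolding has_vector_derivative_def has_derivative_within_alt by (auto simp: real_norm_def)
    then obtain d where d: "\<And>t. t \<in> {a..b} - N \<Longrightarrow> d t > 0"
      "\<And>t s. t \<in> {a..b} - N \<Longrightarrow> s \<in> {a..b} \<Longrightarrow> \<bar>s - t\<bar> < d t \<Longrightarrow>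
         norm (y s - y t - (s - t) *\<^sub>R y' t) \<le> \<eta> * \<bar>s - t\<bar>"
      by metis
    define \<gamma> where "\<gamma> t = (if t \<in> N then U else ball t (if t \<in> {a..b} then d t else 1))" for t
    show "\<exists>\<gamma>. gauge \<gamma> \<and> (\<forall>\<D>. \<D> tagged_division_of {a..b} \<and> \<gamma> fine \<D> \<longrightarrow>
             norm ((\<Sum>(x, k)\<in>\<D>. measure lborel k *\<^sub>R v x) - (y b - y a)) < \<epsilon>)"
    proof (intro exI[of _ \<gamma>] conjI allI impI)
      show "gauge \<gamma>" using U(1,2) d(1) by (auto simp: gauge_def \<gamma>_def)
      fix \<D> assume D: "\<D> tagged_division_of {a..b} \<and> \<gamma> fine \<D>"
      then have td: "\<D> tagged_division_of {a..b}" and fine: "\<gamma> fine \<D>" by auto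
      have fin: "finite \<D>" using td by (rule tagged_division_of_finite)
      have K: "\<exists>c e. k = {c..e} \<and> a \<le> c \<and> c \<le> x \<and> x \<le> e \<and> e \<le> b" if xk: "(x, k) \<in> \<D>" for x k
      proof -
        obtain c e where "k = cbox c e" using tagged_division_ofD(4)[OF td xk] by auto
        moreover have "x \<in> k" "k \<subseteq> {a..b}" using tagged_division_ofD(2,3)[OF td xk] by auto
        ultimately show ?thesis by (force simp: subset_iff)
      qed
      \<comment> \<open>Degenerate intervals are left out: several tags may share one of them, and then the map from
        tagged intervals to pairs of endpoints would not be injective.\<close>
      define \<A> where "\<A> = {p \<in> \<D>. fst p \<in> N \<and> Inf (snd p) < Sup (snd p)}"
      have finA: "finite \<A>" using fin by (simp add: \<A>_def)
      define J where "J = (\<lambda>p. (Inf (snd p), Sup (snd p))) ` \<A>"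
      have disj: "interior k \<inter> interior k' = {}" if "(x, k) \<in> \<D>" "(x', k') \<in> \<D>" "(x, k) \<noteq> (x', k')" for x k x' k'
        using tagged_division_ofD(5)[OF td that] .
      have inj: "inj_on (\<lambda>p. (Inf (snd p), Sup (snd p))) \<A>"
      proof (rule inj_onI, clarsimp simp: \<A>_def)
        fix x k x' k'
        assume *: "(x, k) \<in> \<D>" "(x', k') \<in> \<D>" "Inf k' < Sup k'" "Inf k = Inf k'" "Sup k = Sup k'"
        from K[OF *(1)] K[OF *(2)] * have "k = k'" "interior k \<noteq> {}" by auto
        then show "x = x' \<and> k = k'" using disj[OF *(1,2)] by auto
      qed
      have sumJ: "(\<Sum>(r, s)\<in>J. h r s) = (\<Sum>p\<in>\<A>. h (Inf (snd p)) (Sup (snd p)))" for h :: "real \<Rightarrow> real \<Rightarrow> real"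
        unfolding J_def by (subst sum.reindex[OF inj]) simp
      have lenJ: "(\<Sum>(r, s)\<in>J. s - r) < \<delta>"
      proof -
        have "snd ` \<A> division_of \<Union> (snd ` \<A>)"
          using partial_division_of_tagged_division[OF tagged_partial_division_subset[OF
              tagged_division_of_def[THEN iffD1, OF td, THEN conjunct1], of \<A>]]
          by (auto simp: \<A>_def)
        moreover have injs: "inj_on snd \<A>"
          using inj by (auto simp: inj_on_def)
        ultimately have "(\<Sum>p\<in>\<A>. measure lebesgue (snd p)) = measure lebesgue (\<Union> (snd ` \<A>))"
          and meas: "\<Union> (snd ` \<A>) \<in> lmeasurable"
          using content_division[of "snd ` \<A>"] lmeasurable_division by (auto simp: sum.reindex)
        moreover have "measure lebesgue (\<Union> (snd ` \<A>)) \<le> measure lebesgue U"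
        proof (rule measure_mono_fmeasurable)
          show "\<Union> (snd ` \<A>) \<subseteq> U"
            using fine by (fastforce simp: \<A>_def fine_def \<gamma>_def)
        qed (use meas Ulm in auto)
        moreover have "(\<Sum>p\<in>\<A>. measure lebesgue (snd p)) = (\<Sum>p\<in>\<A>. Sup (snd p) - Inf (snd p))"
        proof (rule sum.cong[OF refl], clarsimp simp: \<A>_def)
          fix x k assume "(x, k) \<in> \<D>"
          from K[OF this] show "measure lebesgue k = Sup k - Inf k" by auto
        qed
        ultimately show ?thesis using Ulm(2) sumJ[of "\<lambda>r s. s - r"] by simp
      qed
      have Jb: "(\<Sum>(r, s)\<in>J. dist (y r) (y s)) < \<epsilon> / 2"
      proof (rule \<delta>[OF _ _ _ lenJ])
        show "finite J" by (simp add: J_def finA)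
        show "\<forall>(r, s)\<in>J. a \<le> r \<and> r \<le> s \<and> s \<le> b"
          using K by (fastforce simp: J_def \<A>_def)
        show "disjoint_family_on (\<lambda>(r, s). {r<..<s}) J"
          unfolding disjoint_family_on_def
        proof (intro ballI impI)
          fix p q assume "p \<in> J" "q \<in> J" "p \<noteq> q"
          from \<open>p \<in> J\<close> obtain x k where "(x, k) \<in> \<A>" "p = (Inf k, Sup k)"
            by (auto simp: J_def)
          moreover from \<open>q \<in> J\<close> obtain x' k' where "(x', k') \<in> \<A>" "q = (Inf k', Sup k')"
            by (auto simp: J_def)
          ultimately have *: "(x, k) \<in> \<A>" "(x', k') \<in> \<A>"
              "p = (Inf k, Sup k)" "q = (Inf k', Sup k')" by auto
          then have D: "(x, k) \<in> \<D>" "(x', k') \<in> \<D>" by (auto simp: \<A>_def)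
          have "(x, k) \<noteq> (x', k')" using * \<open>p \<noteq> q\<close> by auto
          from disj[OF D this] K[OF D(1)] K[OF D(2)]
          show "(case p of (r, s) \<Rightarrow> {r<..<s}) \<inter> (case q of (r, s) \<Rightarrow> {r<..<s}) = {}"
            unfolding * by auto
        qed
      qed
      have tot: "(\<Sum>(x, k)\<in>\<D>. y (Sup k) - y (Inf k)) = y b - y a"
        "(\<Sum>(x, k)\<in>\<D>. Sup k - Inf k) = b - a"
        using additive_tagged_division_1[OF \<open>a \<le> b\<close> td, of y]
          additive_tagged_division_1[OF \<open>a \<le> b\<close> td, of "\<lambda>x. x"] by auto
      have tag_le: "norm (measure lborel k *\<^sub>R v x - (y (Sup k) - y (Inf k)))
          \<le> \<eta> * (Sup k - Inf k) + (if (x, k) \<in> \<A> then dist (y (Inf k)) (y (Sup k)) else 0)"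
        if xk: "(x, k) \<in> \<D>" for x k
      proof -
        obtain c e where k: "k = {c..e}" "a \<le> c" "c \<le> x" "x \<le> e" "e \<le> b" using K[OF xk] by auto
        show ?thesis
        proof (cases "x \<in> N")
          case True
          then show ?thesis using k xk \<open>\<eta> > 0\<close>
            by (cases "c = e") (auto simp: v_def \<A>_def dist_norm norm_minus_commute)
        next
          case False
          then have x: "x \<in> {a..b} - N" using k by auto
          have "k \<subseteq> \<gamma> x" using fine xk by (auto simp: fine_def)
          then have "k \<subseteq> ball x (d x)" using x by (simp add: \<gamma>_def)
          moreover have "c \<in> k" "e \<in> k" using k by auto
          ultimately have "c \<in> ball x (d x)" "e \<in> ball x (d x)" by blast+
          then have "\<bar>c - x\<bar> < d x" "\<bar>e - x\<bar> < d x" by (auto simp: dist_real_def)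
          then have 1: "norm (y c - y x - (c - x) *\<^sub>R y' x) \<le> \<eta> * (x - c)"
            and 2: "norm (y e - y x - (e - x) *\<^sub>R y' x) \<le> \<eta> * (e - x)"
            using d(2)[OF x, of c] d(2)[OF x, of e] k by auto
          have "measure lborel k *\<^sub>R v x - (y (Sup k) - y (Inf k)) =
              (y c - y x - (c - x) *\<^sub>R y' x) - (y e - y x - (e - x) *\<^sub>R y' x)"
            using k False by (simp add: v_def algebra_simps)
          also have "norm \<dots> \<le> \<eta> * (x - c) + \<eta> * (e - x)"
            using 1 2 norm_triangle_ineq4 by (smt (verit))
          also have "\<dots> = \<eta> * (Sup k - Inf k)" using k by (simp add: algebra_simps)
          finally show ?thesis using False by (simp add: \<A>_def)
        qed
      qed
      have "norm ((\<Sum>(x, k)\<in>\<D>. measure lborel k *\<^sub>R v x) - (y b - y a))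
          = norm (\<Sum>(x, k)\<in>\<D>. measure lborel k *\<^sub>R v x - (y (Sup k) - y (Inf k)))"
        unfolding tot(1)[symmetric] by (simp add: sum_subtractf case_prod_unfold)
      also have "\<dots> \<le> (\<Sum>(x, k)\<in>\<D>. \<eta> * (Sup k - Inf k) + (if (x, k) \<in> \<A> then dist (y (Inf k)) (y (Sup k)) else 0))"
        by (rule sum_norm_le) (use tag_le in auto)
      also have "\<dots> = \<eta> * (b - a) + (\<Sum>p\<in>\<D>. if p \<in> \<A> then dist (y (Inf (snd p))) (y (Sup (snd p))) else 0)"
        unfolding tot(2)[symmetric] by (simp add: sum.distrib case_prod_unfold sum_distrib_left)
      also have "(\<Sum>p\<in>\<D>. if p \<in> \<A> then dist (y (Inf (snd p))) (y (Sup (snd p))) else 0)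
          = (\<Sum>(r, s)\<in>J. dist (y r) (y s))"
      proof -
        have "\<D> \<inter> \<A> = \<A>" by (auto simp: \<A>_def)
        then show ?thesis unfolding sumJ by (simp add: sum.inter_restrict[OF fin, symmetric])
      qed
      also have "\<eta> * (b - a) + (\<Sum>(r, s)\<in>J. dist (y r) (y s)) < \<epsilon> / 2 + \<epsilon> / 2"
      proof (rule add_le_less_mono[OF _ Jb])
        show "\<eta> * (b - a) \<le> \<epsilon> / 2"
          using \<open>\<epsilon> > 0\<close> \<open>a \<le> b\<close> by (simp add: \<eta>_def field_simps)
      qed
      finally show "norm ((\<Sum>(x, k)\<in>\<D>. measure lborel k *\<^sub>R v x) - (y b - y a)) < \<epsilon>" by simp
    qed
  qed
  then show ?thesis
    by (rule has_integral_spike[OF N, rotated]) (auto simp: v_def)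
qed

section \<open>Solutions of differential inclusions\<close>

lemma solves_inclusion_derivative:
  assumes "solves_inclusion a b F y"
  obtains N y' where "negligible N"
    "\<And>t. t \<in> {a..b} - N \<Longrightarrow> y' t \<in> F t (y t)"
    "\<And>t. t \<in> {a..b} - N \<Longrightarrow> (y has_vector_derivative y' t) (at t within {a..b})"
proof -
  have "AE t in lebesgue_on {a..b}. \<exists>v\<in>F t (y t). (y has_vector_derivative v) (at t within {a..b})"
    using assms by (simp add: solves_inclusion_def)
  then have "AE t in lebesgue. t \<in> {a..b} \<longrightarrow>
      (\<exists>v\<in>F t (y t). (y has_vector_derivative v) (at t within {a..b}))"
    by (subst (asm) AE_restrict_space_iff) auto
  then obtain N where N: "{t \<in> space lebesgue. \<not> (t \<in> {a..b} \<longrightarrow>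
      (\<exists>v\<in>F t (y t). (y has_vector_derivative v) (at t within {a..b})))} \<subseteq> N" "N \<in> null_sets lebesgue"
    by (auto simp: eventually_ae_filter)
  then have "\<exists>v. v \<in> F t (y t) \<and> (y has_vector_derivative v) (at t within {a..b})"
    if "t \<in> {a..b} - N" for t
    using that by auto
  then obtain y' where "\<And>t. t \<in> {a..b} - N \<Longrightarrow>
      y' t \<in> F t (y t) \<and> (y has_vector_derivative y' t) (at t within {a..b})"
    by metis
  then show ?thesis using that[of N y'] N(2) by (auto simp: negligible_iff_null_sets)
qed

text \<open>
  The velocities integrate to \<open>y t - y s\<close> by the fundamental theorem, and \<open>l\<close> commutes with the
  integral. The bound refers to the half-open interval so that it may come from a constraint that is only
  known to hold before an exit time.\<close>

lemma solves_inclusion_linear_le: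
  fixes y :: "real \<Rightarrow> 'b::banach" and l :: "'b \<Rightarrow> real"
  assumes sol: "solves_inclusion a b F y" and "a \<le> s" "s \<le> t" "t \<le> b" and l: "bounded_linear l"
    and le: "\<And>r v. r \<in> {s..<t} \<Longrightarrow> v \<in> F r (y r) \<Longrightarrow> l v \<le> c"
  shows "l (y t - y s) \<le> c * (t - s)"
proof -
  obtain N y' where N: "negligible N" "\<And>t. t \<in> {a..b} - N \<Longrightarrow> y' t \<in> F t (y t)"
    "\<And>t. t \<in> {a..b} - N \<Longrightarrow> (y has_vector_derivative y' t) (at t within {a..b})"
    using solves_inclusion_derivative[OF sol] by metis
  have "(y' has_integral (y t - y s)) {s..t}"
  proof (rule abs_cont_on_has_integral[OF _ \<open>s \<le> t\<close> N(1)])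
    show "abs_cont_on s t y"
      using sol assms by (auto simp: solves_inclusion_def intro: abs_cont_on_subinterval)
    show "(y has_vector_derivative y' r) (at r within {s..t})" if "r \<in> {s..t} - N" for r
      using N(3)[of r] that assms by (auto intro: has_vector_derivative_within_subset)
  qed
  then have "((l \<circ> y') has_integral l (y t - y s)) {s..t}"
    using l by (rule has_integral_linear)
  then have *: "((\<lambda>r. if r \<in> N \<union> {t} then c else l (y' r)) has_integral l (y t - y s)) {s..t}"
    by (rule has_integral_spike[of "N \<union> {t}", rotated 2]) (use N(1) in auto)
  have "((\<lambda>r. c) has_integral (c * (t - s))) {s..t}"
    using has_integral_const_real[of c s t] \<open>s \<le> t\<close> by (simp add: mult.commute)
  then show ?thesis
  proof (rule has_integral_le[OF *])
    fix r assume "r \<in> {s..t}"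
    then show "(if r \<in> N \<union> {t} then c else l (y' r)) \<le> c"
      using le[of r "y' r"] N(2)[of r] assms(2,4) by auto
  qed
qed

text \<open>
  The displacement \<open>\<Delta>x = fst (y t) - fst (y s)\<close> itself serves as the linear functional: the bound on
  \<open>\<Delta>x \<bullet> fst v\<close> for all velocities \<open>v\<close> gives \<open>(norm \<Delta>x)\<^sup>2 \<le> norm \<Delta>x * M * (t - s)\<close>.\<close>

lemma solves_inclusion_fst_norm_le:
  fixes y :: "real \<Rightarrow> 'a::euclidean_space \<times> real"
  assumes sol: "solves_inclusion a b F y" and "a \<le> s" "s \<le> t" "t \<le> b"
    and le: "\<And>r v. r \<in> {s..<t} \<Longrightarrow> v \<in> F r (y r) \<Longrightarrow> norm (fst v) \<le> M"
  shows "norm (fst (y t) - fst (y s)) \<le> M * (t - s)"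
proof (cases "fst (y t) = fst (y s)")
  case True
  show ?thesis
  proof (cases "s = t")
    case False
    obtain N y' where N: "negligible N" "\<And>t. t \<in> {a..b} - N \<Longrightarrow> y' t \<in> F t (y t)"
      using solves_inclusion_derivative[OF sol] by metis
    \<comment> \<open>Some admissible velocity exists, so \<open>M\<close> is not negative.\<close>
    have "\<not> {s<..<t} \<subseteq> N"
      using negligible_subset[OF N(1), of "{s<..<t}"] \<open>s \<le> t\<close> False negligible_interval(2)[of s t] by auto
    then obtain r where "r \<in> {s<..<t}" "r \<notin> N" by blast
    then have "norm (fst (y' r)) \<le> M" using le[of r "y' r"] N(2)[of r] assms by auto
    then have "0 \<le> M" using norm_ge_zero order_trans by blast
    then show ?thesis using True \<open>s \<le> t\<close> by simp
  qed (use True in simp)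
next
  case False
  define w where "w = fst (y t) - fst (y s)"
  have "w \<bullet> fst (y t - y s) \<le> (norm w * M) * (t - s)"
  proof (rule solves_inclusion_linear_le[OF sol \<open>a \<le> s\<close> \<open>s \<le> t\<close> \<open>t \<le> b\<close>])
    show "bounded_linear (\<lambda>v. w \<bullet> fst v)"
      by (rule bounded_linear_compose[OF bounded_linear_inner_right bounded_linear_fst])
    show "w \<bullet> fst v \<le> norm w * M" if "r \<in> {s..<t}" "v \<in> F r (y r)" for r v
      using le[OF that] norm_cauchy_schwarz[of w "fst v"] mult_left_mono[of "norm (fst v)" M "norm w"] by simp
  qed
  then have "norm w * norm w \<le> norm w * (M * (t - s))"
    by (simp add: w_def[symmetric] power2_norm_eq_inner[symmetric] power2_eq_square mult.assoc)
  then show ?thesis using False by (simp add: w_def)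
qed

text \<open>
  At the first time at which the distance to the initial point is at least \<open>\<delta>\<close>, the speed bound has
  been valid throughout, so the distance is at most \<open>M * (t - a) < \<delta>\<close>.\<close>

lemma solves_inclusion_stays:
  fixes y :: "real \<Rightarrow> 'a::euclidean_space \<times> real"
  assumes sol: "solves_inclusion a b F y" and "a \<le> t" "t \<le> b" and "\<delta> > 0" and M: "M * (t - a) < \<delta>" "M \<ge> 0"
    and le: "\<And>r x z v. r \<in> {a..t} \<Longrightarrow> norm (x - fst (y a)) < \<delta> \<Longrightarrow> v \<in> F r (x, z) \<Longrightarrow> norm (fst v) \<le> M"
    and r: "r \<in> {a..t}"
  shows "norm (fst (y r) - fst (y a)) < \<delta>"
proof (rule ccontr)
  define S where "S = {r \<in> {a..t}. \<delta> \<le> norm (fst (y r) - fst (y a))}"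
  assume "\<not> norm (fst (y r) - fst (y a)) < \<delta>"
  then have "r \<in> S" using r by (auto simp: S_def)
  have cont: "continuous_on {a..t} y"
    using abs_cont_on_imp_continuous_on[of a b y] sol \<open>t \<le> b\<close>
    by (auto simp: solves_inclusion_def intro: continuous_on_subset)
  have "closed S" unfolding S_def
    by (intro closed_Collect_le continuous_on_closed_Collect_le continuous_intros cont)
  moreover have "bdd_below S" by (auto simp: S_def)
  ultimately have e: "Inf S \<in> S" using \<open>r \<in> S\<close> closed_contains_Inf by blast
  have before: "norm (fst (y q) - fst (y a)) < \<delta>" if "q \<in> {a..<Inf S}" for q
  proof (rule ccontr)
    assume "\<not> norm (fst (y q) - fst (y a)) < \<delta>"
    then have "q \<in> S" using that e by (auto simp: S_def)
    then have "Inf S \<le> q" using \<open>bdd_below S\<close> cInf_lower by blast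
    then show False using that by simp
  qed
  have "norm (fst (y (Inf S)) - fst (y a)) \<le> M * (Inf S - a)"
  proof (rule solves_inclusion_fst_norm_le[OF sol order_refl])
    show "norm (fst v) \<le> M" if "q \<in> {a..<Inf S}" "v \<in> F q (y q)" for q v
      using le[of q "fst (y q)" v "snd (y q)"] before[OF that(1)] that e by (auto simp: S_def)
  qed (use e \<open>t \<le> b\<close> in \<open>auto simp: S_def\<close>)
  also have "\<dots> \<le> M * (t - a)" using e M(2) by (intro mult_left_mono) (auto simp: S_def)
  also have "\<dots> < \<delta>" by (rule M)
  finally show False using e by (simp add: S_def)
qed

text \<open>
  Both halves of the Hamilton--Jacobi equation come from this statement: \<open>\<kappa> = 1\<close> for a trajectory
  below the graph of \<open>V\<close>, \<open>\<kappa> = -1\<close> for one above it. Follow a trajectory from the graph for a short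
  time \<open>h\<close>. The increment of \<open>V\<close> along it is \<open>a * h + p \<bullet> \<Delta>x\<close> up to a small multiple of \<open>h\<close>, and it is
  compared with \<open>\<Delta>z\<close>; what remains is the increment of \<open>\<kappa> * (p \<bullet> x - z)\<close>, whose rate exceeds \<open>c\<close> by an
  arbitrarily small amount only.

  At the terminal time no trajectory of positive duration starts, so there the trajectory is started at \<open>(T - h, x\<^sub>0)\<close>.
  This suffices because \<open>(T - h, x\<^sub>0)\<close> and the end point are both at distance of order \<open>h\<close>
  from \<open>(T, x\<^sub>0)\<close>, so that differentiability at \<open>(T, x\<^sub>0)\<close> controls \<open>V\<close> at both of them.\<close>

lemma one_sided_hj_inequality:
  fixes V :: "real \<Rightarrow> 'a::euclidean_space \<Rightarrow> real" and F :: "real \<Rightarrow> 'a \<times> real \<Rightarrow> ('a \<times> real) set"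
  assumes "T > 0" and t\<^sub>0: "t\<^sub>0 \<in> {0..T}" and \<kappa>: "\<kappa> = 1 \<or> \<kappa> = -1"
    and D: "((\<lambda>(t, x). V t x) has_derivative (\<lambda>(\<tau>, \<xi>). a * \<tau> + p \<bullet> \<xi>)) (at (t\<^sub>0, x\<^sub>0) within {0..T} \<times> UNIV)"
    and via: "\<And>s. s \<in> {0..T} \<Longrightarrow> \<exists>y. solves_inclusion s T F y \<and> y s = (x\<^sub>0, V s x\<^sub>0) \<and>
        (\<forall>t\<in>{s..T}. \<kappa> * snd (y t) \<le> \<kappa> * V t (fst (y t)))"
    and loc: "\<And>e. e > 0 \<Longrightarrow> \<exists>\<delta>>0. \<forall>r\<in>{0..T}. \<forall>x z. \<forall>v\<in>F r (x, z).
        \<bar>r - t\<^sub>0\<bar> < \<delta> \<longrightarrow> norm (x - x\<^sub>0) < \<delta> \<longrightarrow> norm (fst v) \<le> M \<and> \<kappa> * (p \<bullet> fst v - snd v) \<le> c + e"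
    and "M \<ge> 0"
  shows "0 \<le> \<kappa> * a + c"
proof -
  have key: "0 \<le> \<kappa> * a + c + e * (3 + M)" if "e > 0" for e
  proof -
    obtain \<delta> where "\<delta> > 0" and \<delta>: "\<And>r x z v. r \<in> {0..T} \<Longrightarrow> v \<in> F r (x, z) \<Longrightarrow> \<bar>r - t\<^sub>0\<bar> < \<delta> \<Longrightarrow> norm (x - x\<^sub>0) < \<delta> \<Longrightarrow>
        norm (fst v) \<le> M \<and> \<kappa> * (p \<bullet> fst v - snd v) \<le> c + e"
      using loc[OF \<open>e > 0\<close>] by metis
    obtain \<eta> where "\<eta> > 0" and \<eta>: "\<And>t x. t \<in> {0..T} \<Longrightarrow> norm ((t, x) - (t\<^sub>0, x\<^sub>0)) < \<eta> \<Longrightarrow>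
        \<bar>V t x - V t\<^sub>0 x\<^sub>0 - (a * (t - t\<^sub>0) + p \<bullet> (x - x\<^sub>0))\<bar> \<le> e * norm ((t, x) - (t\<^sub>0, x\<^sub>0))"
      using D[unfolded has_derivative_within_alt] \<open>e > 0\<close> by (force simp: )
    \<comment> \<open>Small enough for the trajectory, of speed at most \<open>M\<close>, to stay \<open>\<delta>\<close>-close to \<open>x\<^sub>0\<close> and for
      both ends of it to be \<open>\<eta>\<close>-close to \<open>(t\<^sub>0, x\<^sub>0)\<close>.\<close>
    define h where "h = (if t\<^sub>0 < T then min (T - t\<^sub>0) else min T) (min \<delta> \<eta> / (2 * (M + 1)))"
    define s where "s = (if t\<^sub>0 < T then t\<^sub>0 else T - h)"
    define t where "t = s + h"
    have h: "h > 0" "(M + 1) * h < \<delta>" "(M + 1) * h < \<eta>"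
    proof -
      show "h > 0" using \<open>\<delta> > 0\<close> \<open>\<eta> > 0\<close> \<open>M \<ge> 0\<close> \<open>T > 0\<close> by (auto simp: h_def)
      have "h \<le> min \<delta> \<eta> / (2 * (M + 1))" by (auto simp: h_def)
      then have "(M + 1) * h \<le> min \<delta> \<eta> / 2" using \<open>M \<ge> 0\<close> by (simp add: field_simps)
      then show "(M + 1) * h < \<delta>" "(M + 1) * h < \<eta>" using \<open>\<delta> > 0\<close> \<open>\<eta> > 0\<close> by auto
    qed
    have st: "s \<in> {0..T}" "t \<in> {0..T}" "s \<le> t" "t \<le> T" "t\<^sub>0 = s \<or> t\<^sub>0 = t"
      using h(1) t\<^sub>0 by (auto simp: s_def t_def h_def)
    obtain y where y: "solves_inclusion s T F y" "y s = (x\<^sub>0, V s x\<^sub>0)"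
      and yV: "\<kappa> * snd (y t) \<le> \<kappa> * V t (fst (y t))"
      using via[OF st(1)] st by auto
    have Mh: "M * h \<le> (M + 1) * h" "h \<le> (M + 1) * h" using \<open>M \<ge> 0\<close> h(1) by (auto simp: algebra_simps)
    have near: "\<bar>r - t\<^sub>0\<bar> < \<delta>" "r \<in> {0..T}" if "r \<in> {s..t}" for r
    proof -
      have "h < \<delta>" using h Mh by linarith
      then show "\<bar>r - t\<^sub>0\<bar> < \<delta>" "r \<in> {0..T}" using that st by (auto simp: t_def)
    qed
    have Fle: "norm (fst v) \<le> M" "\<kappa> * (p \<bullet> fst v - snd v) \<le> c + e"
      if "r \<in> {s..t}" "norm (x - x\<^sub>0) < \<delta>" "v \<in> F r (x, z)" for r x z v
      using \<delta>[OF near(2)[OF that(1)] that(3) near(1)[OF that(1)] that(2)] by auto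
    have stay: "norm (fst (y r) - x\<^sub>0) < \<delta>" if "r \<in> {s..t}" for r
    proof -
      have "norm (fst (y r) - fst (y s)) < \<delta>"
      proof (rule solves_inclusion_stays[OF y(1) st(3,4) \<open>\<delta> > 0\<close> _ \<open>M \<ge> 0\<close>  _ that])
        have "M * h < \<delta>" using h(2) Mh(1) by linarith
        then show "M * (t - s) < \<delta>" by (simp add: t_def)
      qed (use Fle(1) y(2) in auto)
      then show ?thesis using y(2) by simp
    qed
    have Fy: "norm (fst v) \<le> M" "\<kappa> * (p \<bullet> fst v - snd v) \<le> c + e"
      if "r \<in> {s..<t}" "v \<in> F r (y r)" for r v
      using Fle[of r "fst (y r)" v "snd (y r)"] stay[of r] that by auto
    have x: "norm (fst (y t) - x\<^sub>0) \<le> M * h"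
      using solves_inclusion_fst_norm_le[OF y(1) order_refl st(3,4) Fy(1)] y(2)
      by (simp add: t_def)
    have l: "\<kappa> * (p \<bullet> fst (y t - y s) - snd (y t - y s)) \<le> (c + e) * (t - s)"
    proof (rule solves_inclusion_linear_le[OF y(1) order_refl st(3,4)])
      show "bounded_linear (\<lambda>v. \<kappa> * (p \<bullet> fst v - snd v))"
        by (intro bounded_linear_intros bounded_linear_sub bounded_linear_const_mult
            bounded_linear_compose[OF bounded_linear_inner_right bounded_linear_fst] bounded_linear_snd)
      show "\<kappa> * (p \<bullet> fst v - snd v) \<le> c + e" if "r \<in> {s..<t}" "v \<in> F r (y r)" for r v
        using Fy(2)[OF that] .
    qed
    have 1: "\<bar>V t (fst (y t)) - V t\<^sub>0 x\<^sub>0 - (a * (t - t\<^sub>0) + p \<bullet> (fst (y t) - x\<^sub>0))\<bar> \<le> e * ((M + 1) * h)"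
    proof -
      have n: "norm ((t, fst (y t)) - (t\<^sub>0, x\<^sub>0)) \<le> (M + 1) * h"
        using norm_Pair_le[of "t - t\<^sub>0" "fst (y t) - x\<^sub>0"] x st h(1) by (auto simp: t_def algebra_simps)
      then have "\<bar>V t (fst (y t)) - V t\<^sub>0 x\<^sub>0 - (a * (t - t\<^sub>0) + p \<bullet> (fst (y t) - x\<^sub>0))\<bar>
          \<le> e * norm ((t, fst (y t)) - (t\<^sub>0, x\<^sub>0))"
        using \<eta>[OF st(2), of "fst (y t)"] h(3) by simp
      also have "\<dots> \<le> e * ((M + 1) * h)" using n \<open>e > 0\<close> by (intro mult_left_mono) auto
      finally show ?thesis .
    qed
    have 2: "\<bar>V s x\<^sub>0 - V t\<^sub>0 x\<^sub>0 - a * (s - t\<^sub>0)\<bar> \<le> e * h"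
    proof -
      have n: "norm ((s, x\<^sub>0) - (t\<^sub>0, x\<^sub>0)) \<le> h"
        using st h(1) by (auto simp: t_def norm_Pair)
      then have "\<bar>V s x\<^sub>0 - V t\<^sub>0 x\<^sub>0 - a * (s - t\<^sub>0)\<bar> \<le> e * norm ((s, x\<^sub>0) - (t\<^sub>0, x\<^sub>0))"
        using \<eta>[OF st(1), of x\<^sub>0] h(3) Mh by simp
      also have "\<dots> \<le> e * h" using n \<open>e > 0\<close> by (intro mult_left_mono) auto
      finally show ?thesis .
    qed
    define A where "A = V t (fst (y t)) - V s x\<^sub>0 - p \<bullet> (fst (y t) - x\<^sub>0)"
    have A: "\<bar>A - a * h\<bar> \<le> e * ((M + 1) * h) + e * h"
    proof -
      have "A - a * h = (V t (fst (y t)) - V t\<^sub>0 x\<^sub>0 - (a * (t - t\<^sub>0) + p \<bullet> (fst (y t) - x\<^sub>0)))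
          - (V s x\<^sub>0 - V t\<^sub>0 x\<^sub>0 - a * (s - t\<^sub>0))"
        by (simp add: A_def t_def algebra_simps)
      then show ?thesis using 1 2 by linarith
    qed
    have "- ((c + e) * h) \<le> \<kappa> * A"
      using l yV y(2) by (simp add: A_def t_def algebra_simps)
    also have "\<dots> \<le> \<kappa> * (a * h) + (e * ((M + 1) * h) + e * h)"
      using A \<kappa> by auto
    finally have "0 \<le> h * (\<kappa> * a + c + e * (3 + M))" by (simp add: algebra_simps)
    then show ?thesis using h(1) by (simp add: zero_le_mult_iff)
  qed
  show ?thesis
  proof (rule field_le_epsilon)
    fix e :: real assume "e > 0"
    have "0 \<le> \<kappa> * a + c + (e / (3 + M)) * (3 + M)"
      using key[of "e / (3 + M)"] \<open>e > 0\<close> \<open>M \<ge> 0\<close> by simp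
    then show "0 \<le> \<kappa> * a + c + e" using \<open>M \<ge> 0\<close> by simp
  qed
qed

lemma continuous_on_uniform_in_compact_parameter:
  fixes F :: "real \<Rightarrow> 'a::euclidean_space \<Rightarrow> 'u::metric_space \<Rightarrow> 'c::metric_space"
  assumes "compact P" and cont: "continuous_on ({0..T} \<times> UNIV \<times> P) (\<lambda>(t, x, u). F t x u)"
    and "t \<in> {0..T}" and "e > 0"
  shows "\<exists>\<delta>>0. \<forall>s\<in>{0..T}. \<forall>y. \<bar>s - t\<bar> < \<delta> \<longrightarrow> norm (y - x) < \<delta> \<longrightarrow>
    (\<forall>u\<in>P. dist (F s y u) (F t x u) < e)"
proof -
  have "uniformly_continuous_on ({0..T} \<times> cball x 1 \<times> P) (\<lambda>(t, x, u). F t x u)"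
    using assms(1) by (intro compact_uniformly_continuous continuous_on_subset[OF cont] compact_Times) auto
  then obtain \<delta> where "\<delta> > 0" and \<delta>: "\<And>q q'. q \<in> {0..T} \<times> cball x 1 \<times> P \<Longrightarrow> q' \<in> {0..T} \<times> cball x 1 \<times> P \<Longrightarrow>
      dist q' q < \<delta> \<Longrightarrow> dist (case q' of (t, x, u) \<Rightarrow> F t x u) (case q of (t, x, u) \<Rightarrow> F t x u) < e"
    using \<open>e > 0\<close> unfolding uniformly_continuous_on_def by metis
  show ?thesis
  proof (intro exI[of _ "min 1 (\<delta> / 2)"] conjI ballI allI impI)
    fix s y u assume s: "s \<in> {0..T}" "\<bar>s - t\<bar> < min 1 (\<delta> / 2)" "norm (y - x) < min 1 (\<delta> / 2)" "u \<in> P"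
    have "dist (s, y, u) (t, x, u) \<le> dist s t + dist y x"
      by (simp add: dist_Pair_Pair sqrt_sum_squares_le_sum)
    also have "\<dots> < \<delta>" using s by (simp add: dist_real_def dist_norm)
    finally show "dist (F s y u) (F t x u) < e"
      using \<delta>[of "(t, x, u)" "(s, y, u)"] s assms(3) by (auto simp: dist_norm norm_minus_commute)
  qed (use \<open>\<delta> > 0\<close> in auto)
qed

lemma viableD:
  assumes "viable T D F" "(s, y\<^sub>0) \<in> D"
  obtains y where "solves_inclusion s T F y" "y s = y\<^sub>0" "\<And>t. t \<in> {s..T} \<Longrightarrow> (t, y t) \<in> D"
proof -
  have "\<exists>y. solves_inclusion s T F y \<and> y s = y\<^sub>0 \<and> (\<forall>t\<in>{s..T}. (t, y t) \<in> D)"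
    using bspec[OF assms(1)[unfolded viable_def] assms(2)] by simp
  then show ?thesis using that by auto
qed

section \<open>Gradients\<close>

lemma grad_eqI: "GDERIV F x :> D \<Longrightarrow> grad F x = D"
  unfolding grad_def gderiv_def
proof (rule the_equality)
  fix D' assume "(F has_derivative (\<lambda>h. h \<bullet> D)) (at x)" "(F has_derivative (\<lambda>h. h \<bullet> D')) (at x)"
  then have "(\<lambda>h. h \<bullet> D') = (\<lambda>h. h \<bullet> D)" by (rule has_derivative_unique[symmetric])
  then have "h \<bullet> (D' - D) = 0" for h by (metis inner_diff_right diff_self)
  then show "D' = D" by (metis inner_eq_zero_iff right_minus_eq)
qed

lemma GDERIV_grad:
  fixes F :: "'a::euclidean_space \<Rightarrow> real"
  assumes "F differentiable (at x)"
  shows "GDERIV F x :> grad F x"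
proof -
  obtain L where L: "(F has_derivative L) (at x)" using assms by (auto simp: differentiable_def)
  then have "linear L" by (rule has_derivative_linear)
  then have "L = (\<lambda>h. h \<bullet> adjoint L 1)" by (simp add: adjoint_works fun_eq_iff)
  then have "GDERIV F x :> adjoint L 1" using L by (simp add: gderiv_def)
  then show ?thesis using grad_eqI by metis
qed

section \<open>The Hamiltonian along an external field\<close>

locale mfg_flow =
  fixes T :: real
    and P :: "'u::metric_space set"
    and f :: "real \<Rightarrow> real^'n::finite \<Rightarrow> (real^'n) prob1 \<Rightarrow> 'u \<Rightarrow> real^'n"
    and g :: "real \<Rightarrow> real^'n \<Rightarrow> (real^'n) prob1 \<Rightarrow> 'u \<Rightarrow> real"
    and \<mu> :: "real \<Rightarrow> (real^'n) prob1"
    and L :: real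
  assumes T_pos: "T > 0"
    and P_compact: "compact P" "P \<noteq> {}"
    and f_cont: "continuous_on ({0..T} \<times> UNIV \<times> UNIV \<times> P) (\<lambda>(t, x, m, u). f t x m u)"
    and g_cont: "continuous_on ({0..T} \<times> UNIV \<times> UNIV \<times> P) (\<lambda>(t, x, m, u). g t x m u)"
    and f_lipschitz: "\<And>t x' x'' m u. t \<in> {0..T} \<Longrightarrow> u \<in> P \<Longrightarrow>
          norm (f t x' m u - f t x'' m u) \<le> L * norm (x' - x'')"
    and \<mu>_cont: "continuous_on {0..T} \<mu>"
    and H_diff: "\<And>t x p. t \<in> {0..T} \<Longrightarrow> hamiltonian P f g t x (\<mu> t) differentiable (at p)"
begin

abbreviation H :: "real \<Rightarrow> real^'n \<Rightarrow> real^'n \<Rightarrow> real" where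
  "H t x \<equiv> hamiltonian P f g t x (\<mu> t)"

lemma continuous_along_flow:
  fixes \<Phi> :: "real \<Rightarrow> real^'n \<Rightarrow> (real^'n) prob1 \<Rightarrow> 'u \<Rightarrow> 'c::topological_space"
  assumes "continuous_on ({0..T} \<times> UNIV \<times> UNIV \<times> P) (\<lambda>(t, x, m, u). \<Phi> t x m u)"
  shows "continuous_on ({0..T} \<times> UNIV \<times> P) (\<lambda>(t, x, u). \<Phi> t x (\<mu> t) u)"
proof -
  have "continuous_on ({0..T} \<times> UNIV \<times> P) (\<lambda>(t, x, u). (t, x :: real^'n, \<mu> t, u))"
    unfolding case_prod_unfold
    by (intro continuous_intros continuous_on_compose2[OF \<mu>_cont]) auto
  from continuous_on_compose2[OF assms this]
  show ?thesis by (simp add: case_prod_unfold mem_Times_iff subset_iff image_iff)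
qed

lemmas f_flow_cont = continuous_along_flow[OF f_cont] and g_flow_cont = continuous_along_flow[OF g_cont]

lemma fg_flow_cont:
  "continuous_on ({0..T} \<times> UNIV \<times> P) (\<lambda>(t, x, u). (f t x (\<mu> t) u, g t x (\<mu> t) u))"
  using continuous_on_Pair[OF f_flow_cont g_flow_cont] by (simp add: case_prod_unfold)

lemma f_control_cont: "t \<in> {0..T} \<Longrightarrow> continuous_on P (\<lambda>u. f t x (\<mu> t) u)"
  and g_control_cont: "t \<in> {0..T} \<Longrightarrow> continuous_on P (\<lambda>u. g t x (\<mu> t) u)"
proof -
  assume t: "t \<in> {0..T}"
  have "continuous_on P (\<lambda>u. (t, x, u))" by (intro continuous_intros)
  moreover have "(\<lambda>u. (t, x, u)) ` P \<subseteq> {0..T} \<times> UNIV \<times> P" using t by auto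
  ultimately show "continuous_on P (\<lambda>u. f t x (\<mu> t) u)" "continuous_on P (\<lambda>u. g t x (\<mu> t) u)"
    using continuous_on_compose2[OF f_flow_cont, of P "\<lambda>u. (t, x, u)"]
      continuous_on_compose2[OF g_flow_cont, of P "\<lambda>u. (t, x, u)"] by auto
qed

lemma prehamiltonian_cont:
  "t \<in> {0..T} \<Longrightarrow> continuous_on P (\<lambda>u. p \<bullet> f t x (\<mu> t) u - g t x (\<mu> t) u)"
  by (intro continuous_intros f_control_cont g_control_cont)

lemma bdd_above_prehamiltonian:
  "t \<in> {0..T} \<Longrightarrow> bdd_above ((\<lambda>u. p \<bullet> f t x (\<mu> t) u - g t x (\<mu> t) u) ` P)"
  by (intro bounded_imp_bdd_above compact_imp_bounded compact_continuous_image
      prehamiltonian_cont P_compact(1))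

lemma hamiltonian_upper:
  assumes "t \<in> {0..T}" "u \<in> P"
  shows "p \<bullet> f t x (\<mu> t) u - g t x (\<mu> t) u \<le> H t x p"
  unfolding hamiltonian_def by (rule cSUP_upper[OF assms(2) bdd_above_prehamiltonian[OF assms(1)]])

lemma hamiltonian_attained:
  assumes "t \<in> {0..T}"
  obtains u where "u \<in> P" "H t x p = p \<bullet> f t x (\<mu> t) u - g t x (\<mu> t) u"
proof -
  obtain u where u: "u \<in> P" "\<And>u'. u' \<in> P \<Longrightarrow>
      p \<bullet> f t x (\<mu> t) u' - g t x (\<mu> t) u' \<le> p \<bullet> f t x (\<mu> t) u - g t x (\<mu> t) u"
    using continuous_attains_sup[OF P_compact prehamiltonian_cont[OF assms, of p x]] by auto
  have "H t x p \<le> p \<bullet> f t x (\<mu> t) u - g t x (\<mu> t) u"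
    unfolding hamiltonian_def using u(2) P_compact(2) by (intro cSUP_least)
  then show ?thesis using that[OF u(1)] hamiltonian_upper[OF assms u(1), of p x] by simp
qed

lemma E_minus_in_convex:
  assumes "convex C" "\<And>u. u \<in> P \<Longrightarrow> (f t x m u, g t x m u) \<in> C" "v \<in> E_minus P f g t x m"
  shows "v \<in> C"
proof -
  have "(\<lambda>u. (f t x m u, g t x m u)) ` P \<subseteq> C" using assms(2) by auto
  then have "E_minus P f g t x m \<subseteq> C" unfolding E_minus_def using assms(1) by (rule hull_minimal)
  then show ?thesis using assms(3) by auto
qed

text \<open>This set is a half-space with normal \<open>(p, -1)\<close>.\<close>

lemma convex_legendre_halfspace: "convex {v :: (real^'n) \<times> real. p \<bullet> fst v - snd v \<le> c}"
  using convex_halfspace_le[of "(p, -1 :: real)" c] by (simp add: inner_prod_def)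

lemma E_minus_le_hamiltonian:
  assumes "t \<in> {0..T}" "v \<in> E_minus P f g t x (\<mu> t)"
  shows "p \<bullet> fst v - snd v \<le> H t x p"
  using E_minus_in_convex[OF convex_legendre_halfspace _ assms(2), of p "H t x p"]
    hamiltonian_upper[OF assms(1)] by simp

text \<open>
  \<open>v\<close> is a subgradient of the Hamiltonian at \<open>p\<close>: the difference \<open>H q - (q \<bullet> v - w)\<close> is minimal at \<open>q = p\<close>,
  so its derivative vanishes there.\<close>

lemma grad_hamiltonian_eqI:
  assumes "t \<in> {0..T}" and le: "\<And>q. q \<bullet> v - w \<le> H t x q" and eq: "p \<bullet> v - w = H t x p"
  shows "grad (H t x) p = v"
proof -
  have "GDERIV (H t x) p :> grad (H t x) p" by (rule GDERIV_grad[OF H_diff[OF assms(1)]])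
  then have "((\<lambda>q. H t x q - (q \<bullet> v - w)) has_derivative (\<lambda>h. h \<bullet> grad (H t x) p - h \<bullet> v)) (at p)"
    unfolding gderiv_def by (auto intro!: derivative_eq_intros)
  then have "(\<lambda>h. h \<bullet> grad (H t x) p - h \<bullet> v) = (\<lambda>h. 0)"
    by (rule has_derivative_local_min) (use le eq in \<open>auto simp: le_diff_eq\<close>)
  then have "(grad (H t x) p - v) \<bullet> (grad (H t x) p - v) = 0"
    by (metis inner_diff_right)
  then show ?thesis by simp
qed

lemma f_linear_growth:
  obtains C where "C \<ge> 0" "\<And>t x u. t \<in> {0..T} \<Longrightarrow> u \<in> P \<Longrightarrow> norm (f t x (\<mu> t) u) \<le> C + \<bar>L\<bar> * norm x"
proof -
  have "continuous_on ({0..T} \<times> P) (\<lambda>(t, u). f t 0 (\<mu> t) u)"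
  proof -
    have "continuous_on ({0..T} \<times> P) (\<lambda>q. (fst q, 0 :: real^'n, snd q))"
      by (intro continuous_intros)
    moreover have "(\<lambda>q. (fst q, 0, snd q)) ` ({0..T} \<times> P) \<subseteq> {0..T} \<times> UNIV \<times> P" by auto
    ultimately show ?thesis
      using continuous_on_compose2[OF f_flow_cont] by (fastforce simp: case_prod_unfold)
  qed
  then have "compact ((\<lambda>(t, u). f t 0 (\<mu> t) u) ` ({0..T} \<times> P))"
    using P_compact(1) by (intro compact_continuous_image compact_Times) auto
  then have "bounded ((\<lambda>(t, u). f t 0 (\<mu> t) u) ` ({0..T} \<times> P))" by (rule compact_imp_bounded)
  then obtain C where "\<And>v. v \<in> (\<lambda>(t, u). f t 0 (\<mu> t) u) ` ({0..T} \<times> P) \<Longrightarrow> norm v \<le> C"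
    unfolding bounded_iff by blast
  then have C: "norm (f t 0 (\<mu> t) u) \<le> C" if "t \<in> {0..T}" "u \<in> P" for t u using that by force
  obtain u where "u \<in> P" using P_compact(2) by auto
  then have "norm (f 0 0 (\<mu> 0) u) \<le> C" using C[of 0 u] T_pos by simp
  then have "0 \<le> C" using norm_ge_zero order_trans by blast
  moreover have "norm (f t x (\<mu> t) u) \<le> C + \<bar>L\<bar> * norm x" if "t \<in> {0..T}" "u \<in> P" for t x u
  proof -
    have "norm (f t x (\<mu> t) u) \<le> norm (f t 0 (\<mu> t) u) + norm (f t x (\<mu> t) u - f t 0 (\<mu> t) u)"
      by (rule norm_triangle_sub)
    also have "\<dots> \<le> C + L * norm x" using C[OF that] f_lipschitz[OF that, of x "\<mu> t" 0] by simp
    also have "\<dots> \<le> C + \<bar>L\<bar> * norm x" by (simp add: mult_right_mono)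
    finally show ?thesis .
  qed
  ultimately show ?thesis using that by blast
qed

text \<open>
  For a control that attains the maximum, the drift is a subgradient. Hence every gradient of the
  Hamiltonian is a value of the drift and inherits its linear growth.\<close>

lemma grad_hamiltonian_growth:
  obtains C where "C \<ge> 0" "\<And>t x p. t \<in> {0..T} \<Longrightarrow> norm (grad (H t x) p) \<le> C + \<bar>L\<bar> * norm x"
proof -
  obtain C where C: "C \<ge> 0" "\<And>t x u. t \<in> {0..T} \<Longrightarrow> u \<in> P \<Longrightarrow> norm (f t x (\<mu> t) u) \<le> C + \<bar>L\<bar> * norm x"
    using f_linear_growth by blast
  have "norm (grad (H t x) p) \<le> C + \<bar>L\<bar> * norm x" if t: "t \<in> {0..T}" for t x p
  proof -
    obtain u where u: "u \<in> P" "H t x p = p \<bullet> f t x (\<mu> t) u - g t x (\<mu> t) u"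
      using hamiltonian_attained[OF t] .
    have "grad (H t x) p = f t x (\<mu> t) u"
      using grad_hamiltonian_eqI[OF t hamiltonian_upper[OF t u(1)] u(2)[symmetric]] .
    then show ?thesis using C(2)[OF t u(1)] by simp
  qed
  then show ?thesis using that C(1) by blast
qed

end

section \<open>The Hamilton--Jacobi equation\<close>

locale mfg_value = mfg_flow T P f g \<mu> L
  for T :: real
    and P :: "'u::metric_space set"
    and f :: "real \<Rightarrow> real^'n::finite \<Rightarrow> (real^'n) prob1 \<Rightarrow> 'u \<Rightarrow> real^'n"
    and g \<mu> L +
  fixes V :: "real \<Rightarrow> real^'n \<Rightarrow> real"
  assumes V_diff: "(\<lambda>(t, x). V t x) differentiable_on {0..T} \<times> UNIV"
    and epi_viable: "\<And>u. u \<in> P \<Longrightarrow> viable T (epi T V) (\<lambda>t (x, z). E_plus f g t x (\<mu> t) u)"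
    and hypo_viable: "viable T (hypo T V) (\<lambda>t (x, z). E_minus P f g t x (\<mu> t))"
begin

lemma value_derivatives:
  assumes t: "t \<in> {0..T}"
  obtains a where
    "((\<lambda>(t, x). V t x) has_derivative (\<lambda>(\<tau>, \<xi>). a * \<tau> + grad (V t) x \<bullet> \<xi>)) (at (t, x) within {0..T} \<times> UNIV)"
    "GDERIV (V t) x :> grad (V t) x"
    "((\<lambda>s. V s x) has_real_derivative a) (at t within {0..T})"
proof -
  obtain D where D: "((\<lambda>(t, x). V t x) has_derivative D) (at (t, x) within {0..T} \<times> UNIV)"
    using V_diff t unfolding differentiable_on_def differentiable_def by blast
  interpret D: linear D using D by (rule has_derivative_linear)
  have "((\<lambda>s. (s, x)) has_derivative (\<lambda>\<tau>. (\<tau>, 0))) (at t within {0..T})"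
    by (auto intro!: derivative_eq_intros)
  from has_derivative_in_compose[OF this has_derivative_subset[OF D]]
  have 1: "((\<lambda>s. V s x) has_derivative (\<lambda>\<tau>. D (\<tau>, 0))) (at t within {0..T})" by auto
  have "((\<lambda>y. (t, y)) has_derivative (\<lambda>\<xi>. (0, \<xi>))) (at x)"
    by (auto intro!: derivative_eq_intros)
  moreover have "range (Pair t) \<subseteq> {0..T} \<times> (UNIV :: (real^'n) set)" using t by auto
  ultimately have 2: "(V t has_derivative (\<lambda>\<xi>. D (0, \<xi>))) (at x)"
    using has_derivative_in_compose[of "Pair t" "Pair 0" x UNIV "\<lambda>(t, x). V t x" D]
      has_derivative_subset[OF D, of "range (Pair t)"] by simp
  have G: "GDERIV (V t) x :> grad (V t) x"
    using 2 by (intro GDERIV_grad) (auto simp: differentiable_def)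
  then have p: "D (0, \<xi>) = \<xi> \<bullet> grad (V t) x" for \<xi>
    using has_derivative_unique[OF 2] by (simp add: gderiv_def fun_eq_iff)
  have a: "D (\<tau>, 0) = D (1, 0) * \<tau>" for \<tau>
    using D.scale[of \<tau> "(1, 0)"] by simp
  have "D = (\<lambda>(\<tau>, \<xi>). D (1, 0) * \<tau> + grad (V t) x \<bullet> \<xi>)"
  proof (clarsimp simp: fun_eq_iff)
    fix \<tau> \<xi>
    have "D (\<tau>, \<xi>) = D (\<tau>, 0) + D (0, \<xi>)" using D.add[of "(\<tau>, 0)" "(0, \<xi>)"] by simp
    then show "D (\<tau>, \<xi>) = D (1, 0) * \<tau> + grad (V t) x \<bullet> \<xi>"
      using a[of \<tau>] p[of \<xi>] by (simp add: inner_commute)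
  qed
  moreover have "((\<lambda>s. V s x) has_real_derivative D (1, 0)) (at t within {0..T})"
    unfolding has_field_derivative_def using 1 by (rule has_derivative_eq_rhs) (rule ext, rule a)
  ultimately show ?thesis
    using that[of "D (1, 0)"] D G by metis
qed

text \<open>
  Viability of the hypograph gives \<open>a + H \<ge> 0\<close>, viability of the epigraph under a maximising constant
  control gives \<open>a + H \<le> 0\<close>. The rate bound near \<open>(t, x)\<close> holds uniformly in the control because \<open>P\<close> is
  compact, and it passes to the convex hull because the conditions on the velocity define
  convex sets.\<close>

lemma hj_pointwise:
  assumes t: "t \<in> {0..T}"
    and D: "((\<lambda>(t, x). V t x) has_derivative (\<lambda>(\<tau>, \<xi>). a * \<tau> + p \<bullet> \<xi>)) (at (t, x) within {0..T} \<times> UNIV)"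
  shows "a + H t x p = 0"
proof -
  obtain M where M: "M \<ge> 0" "\<And>u. u \<in> P \<Longrightarrow> norm (f t x (\<mu> t) u) \<le> M"
  proof -
    obtain C where "C \<ge> 0" "\<And>t x u. t \<in> {0..T} \<Longrightarrow> u \<in> P \<Longrightarrow> norm (f t x (\<mu> t) u) \<le> C + \<bar>L\<bar> * norm x"
      using f_linear_growth by blast
    then show ?thesis using that[of "C + \<bar>L\<bar> * norm x"] t by simp
  qed
  have loc: "\<exists>\<delta>>0. \<forall>r\<in>{0..T}. \<forall>y. \<bar>r - t\<bar> < \<delta> \<longrightarrow> norm (y - x) < \<delta> \<longrightarrow> (\<forall>u\<in>P.
      norm (f r y (\<mu> r) u) \<le> M + 1 \<and>
      \<bar>(p \<bullet> f r y (\<mu> r) u - g r y (\<mu> r) u) - (p \<bullet> f t x (\<mu> t) u - g t x (\<mu> t) u)\<bar> \<le> e)"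
    if "e > 0" for e
  proof -
    define e' where "e' = min 1 (e / (norm p + 1))"
    have e': "e' > 0" "e' \<le> 1" "(norm p + 1) * e' \<le> e"
    proof -
      have "norm p + 1 > 0" by (simp add: add_nonneg_pos)
      then show "e' > 0" using \<open>e > 0\<close> by (simp add: e'_def)
      have "e' \<le> e / (norm p + 1)" by (simp add: e'_def)
      then show "(norm p + 1) * e' \<le> e" using \<open>norm p + 1 > 0\<close> by (simp add: field_simps)
    qed (simp add: e'_def)
    obtain \<delta> where "\<delta> > 0" and \<delta>: "\<And>r y u. r \<in> {0..T} \<Longrightarrow> \<bar>r - t\<bar> < \<delta> \<Longrightarrow> norm (y - x) < \<delta> \<Longrightarrow> u \<in> P \<Longrightarrow>
        dist (f r y (\<mu> r) u, g r y (\<mu> r) u) (f t x (\<mu> t) u, g t x (\<mu> t) u) < e'"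
      using continuous_on_uniform_in_compact_parameter[OF P_compact(1) fg_flow_cont t e'(1), of x] by metis
    show ?thesis
    proof (intro exI[of _ \<delta>] conjI ballI allI impI \<open>\<delta> > 0\<close>)
      fix r y u assume *: "r \<in> {0..T}" "\<bar>r - t\<bar> < \<delta>" "norm (y - x) < \<delta>" "u \<in> P"
      define F where "F = f r y (\<mu> r) u - f t x (\<mu> t) u"
      define G where "G = g r y (\<mu> r) u - g t x (\<mu> t) u"
      have "norm (F, G) < e'" using \<delta>[OF *] by (simp add: dist_norm F_def G_def)
      then have F: "norm F < e'" and G: "\<bar>G\<bar> < e'"
        using norm_fst_le[of F G] norm_snd_le[of G F] by auto
      show "norm (f r y (\<mu> r) u) \<le> M + 1"
        using norm_triangle_sub[of "f r y (\<mu> r) u" "f t x (\<mu> t) u"] F M(2)[OF *(4)] e' by (simp add: F_def)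
      have "\<bar>p \<bullet> F - G\<bar> \<le> norm p * norm F + \<bar>G\<bar>"
        using Cauchy_Schwarz_ineq2[of p F] by linarith
      also have "\<dots> \<le> norm p * e' + e'"
        using F G by (intro add_mono mult_left_mono) auto
      also have "\<dots> \<le> e" using e' by (simp add: algebra_simps)
      finally show "\<bar>(p \<bullet> f r y (\<mu> r) u - g r y (\<mu> r) u) - (p \<bullet> f t x (\<mu> t) u - g t x (\<mu> t) u)\<bar> \<le> e"
        by (simp add: F_def G_def inner_diff_right algebra_simps)
    qed
  qed
  have "0 \<le> 1 * a + H t x p"
  proof (rule one_sided_hj_inequality[OF T_pos t _ D, where F = "\<lambda>t (x, z). E_minus P f g t x (\<mu> t)" and M = "M + 1"])
    show "\<exists>y. solves_inclusion s T (\<lambda>t (x, z). E_minus P f g t x (\<mu> t)) y \<and> y s = (x, V s x) \<and>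
        (\<forall>t\<in>{s..T}. 1 * snd (y t) \<le> 1 * V t (fst (y t)))" if "s \<in> {0..T}" for s
    proof -
      have "(s, (x, V s x)) \<in> hypo T V" using that by (simp add: hypo_def)
      then obtain y where "solves_inclusion s T (\<lambda>t (x, z). E_minus P f g t x (\<mu> t)) y" "y s = (x, V s x)"
          "\<And>t. t \<in> {s..T} \<Longrightarrow> (t, y t) \<in> hypo T V"
        by (rule viableD[OF hypo_viable]) (rule that)
      then show ?thesis by (intro exI[of _ y]) (force simp: hypo_def split_beta)
    qed
    fix e :: real assume "e > 0"
    then obtain \<delta> where "\<delta> > 0" and \<delta>: "\<And>r y u. r \<in> {0..T} \<Longrightarrow> \<bar>r - t\<bar> < \<delta> \<Longrightarrow> norm (y - x) < \<delta> \<Longrightarrow> u \<in> P \<Longrightarrow>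
      norm (f r y (\<mu> r) u) \<le> M + 1 \<and>
      \<bar>(p \<bullet> f r y (\<mu> r) u - g r y (\<mu> r) u) - (p \<bullet> f t x (\<mu> t) u - g t x (\<mu> t) u)\<bar> \<le> e"
      using loc[of e] by meson
    show "\<exists>\<delta>>0. \<forall>r\<in>{0..T}. \<forall>y z. \<forall>v\<in>(case (y, z :: real) of (x, z) \<Rightarrow> E_minus P f g r x (\<mu> r)).
        \<bar>r - t\<bar> < \<delta> \<longrightarrow> norm (y - x) < \<delta> \<longrightarrow> norm (fst v) \<le> M + 1 \<and> 1 * (p \<bullet> fst v - snd v) \<le> H t x p + e"
    proof (intro exI[of _ \<delta>] conjI[OF \<open>\<delta> > 0\<close>] ballI allI impI)
      fix r y z v assume *: "r \<in> {0..T}" "v \<in> (case (y, z :: real) of (x, z) \<Rightarrow> E_minus P f g r x (\<mu> r))"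
        "\<bar>r - t\<bar> < \<delta>" "norm (y - x) < \<delta>"
      have "convex {v :: (real^'n) \<times> real. norm (fst v) \<le> M + 1}"
        using convex_linear_vimage[OF linear_fst convex_cball[of 0 "M + 1"]] by (simp add: vimage_def)
      then have "convex ({v. norm (fst v) \<le> M + 1} \<inter> {v. p \<bullet> fst v - snd v \<le> H t x p + e})"
        by (intro convex_Int convex_legendre_halfspace)
      then have "v \<in> {v. norm (fst v) \<le> M + 1} \<inter> {v. p \<bullet> fst v - snd v \<le> H t x p + e}"
      proof (rule E_minus_in_convex)
        show "(f r y (\<mu> r) u, g r y (\<mu> r) u) \<in> {v. norm (fst v) \<le> M + 1} \<inter> {v. p \<bullet> fst v - snd v \<le> H t x p + e}"
          if "u \<in> P" for u
          using \<delta>[OF *(1,3,4) that] hamiltonian_upper[OF t that, of p x] by auto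
      qed (use *(2) in simp)
      then show "norm (fst v) \<le> M + 1 \<and> 1 * (p \<bullet> fst v - snd v) \<le> H t x p + e"
        by simp
    qed
  qed (use M in auto)
  moreover have "0 \<le> - 1 * a + - (p \<bullet> f t x (\<mu> t) u - g t x (\<mu> t) u)" if u: "u \<in> P" for u
  proof (rule one_sided_hj_inequality[OF T_pos t _ D, where F = "\<lambda>t (x, z). E_plus f g t x (\<mu> t) u" and M = "M + 1"])
    show "\<exists>y. solves_inclusion s T (\<lambda>t (x, z). E_plus f g t x (\<mu> t) u) y \<and> y s = (x, V s x) \<and>
        (\<forall>t\<in>{s..T}. - 1 * snd (y t) \<le> - 1 * V t (fst (y t)))" if "s \<in> {0..T}" for s
    proof -
      have "(s, (x, V s x)) \<in> epi T V" using that by (simp add: epi_def)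
      then obtain y where "solves_inclusion s T (\<lambda>t (x, z). E_plus f g t x (\<mu> t) u) y" "y s = (x, V s x)"
          "\<And>t. t \<in> {s..T} \<Longrightarrow> (t, y t) \<in> epi T V"
        by (rule viableD[OF epi_viable[OF u]]) (rule that)
      then show ?thesis by (intro exI[of _ y]) (force simp: epi_def split_beta)
    qed
    fix e :: real assume "e > 0"
    then obtain \<delta> where "\<delta> > 0" and \<delta>: "\<And>r y u. r \<in> {0..T} \<Longrightarrow> \<bar>r - t\<bar> < \<delta> \<Longrightarrow> norm (y - x) < \<delta> \<Longrightarrow> u \<in> P \<Longrightarrow>
      norm (f r y (\<mu> r) u) \<le> M + 1 \<and>
      \<bar>(p \<bullet> f r y (\<mu> r) u - g r y (\<mu> r) u) - (p \<bullet> f t x (\<mu> t) u - g t x (\<mu> t) u)\<bar> \<le> e"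
      using loc[of e] by meson
    show "\<exists>\<delta>>0. \<forall>r\<in>{0..T}. \<forall>y z. \<forall>v\<in>(case (y, z :: real) of (x, z) \<Rightarrow> E_plus f g r x (\<mu> r) u).
        \<bar>r - t\<bar> < \<delta> \<longrightarrow> norm (y - x) < \<delta> \<longrightarrow> norm (fst v) \<le> M + 1 \<and>
        - 1 * (p \<bullet> fst v - snd v) \<le> - (p \<bullet> f t x (\<mu> t) u - g t x (\<mu> t) u) + e"
    proof (intro exI[of _ \<delta>] conjI[OF \<open>\<delta> > 0\<close>] ballI allI impI)
      fix r y z v assume *: "r \<in> {0..T}" "v \<in> (case (y, z :: real) of (x, z) \<Rightarrow> E_plus f g r x (\<mu> r) u)"
        "\<bar>r - t\<bar> < \<delta>" "norm (y - x) < \<delta>"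
      then show "norm (fst v) \<le> M + 1 \<and>
          - 1 * (p \<bullet> fst v - snd v) \<le> - (p \<bullet> f t x (\<mu> t) u - g t x (\<mu> t) u) + e"
        using \<delta>[OF *(1,3,4) u] by (auto simp: E_plus_def)
    qed
  qed (use M in auto)
  moreover obtain u where "u \<in> P" "H t x p = p \<bullet> f t x (\<mu> t) u - g t x (\<mu> t) u"
    using hamiltonian_attained[OF t] .
  ultimately show ?thesis by fastforce
qed

end

section \<open>Measurability\<close>

text \<open>Each component of the gradient is a limit of measurable difference quotients.\<close>

lemma borel_measurable_grad:
  fixes F :: "'q \<Rightarrow> 'a::euclidean_space \<Rightarrow> real"
  assumes meas: "(\<lambda>(q, x). F q x) \<in> borel_measurable (M \<Otimes>\<^sub>M borel)"
    and diff: "\<And>q x. q \<in> space M \<Longrightarrow> F q differentiable (at x)"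
  shows "(\<lambda>(q, x). grad (F q) x) \<in> borel_measurable (M \<Otimes>\<^sub>M borel)"
  unfolding borel_measurable_euclidean_space[where f = "\<lambda>(q, x). grad (F q) x"]
proof
  fix b :: 'a assume "b \<in> Basis"
  define h :: "nat \<Rightarrow> real" where "h n = 1 / real (Suc n)" for n
  show "(\<lambda>z. (case z of (q, x) \<Rightarrow> grad (F q) x) \<bullet> b) \<in> borel_measurable (M \<Otimes>\<^sub>M borel)"
  proof (rule borel_measurable_LIMSEQ_metric)
    show "(\<lambda>z. (F (fst z) (snd z + h n *\<^sub>R b) - F (fst z) (snd z)) / h n) \<in> borel_measurable (M \<Otimes>\<^sub>M borel)" for n
    proof -
      have "(\<lambda>z. (fst z, snd z + h n *\<^sub>R b)) \<in> measurable (M \<Otimes>\<^sub>M borel) (M \<Otimes>\<^sub>M borel)" by measurable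
      from measurable_compose[OF this meas]
      have [measurable]: "(\<lambda>z. F (fst z) (snd z + h n *\<^sub>R b)) \<in> borel_measurable (M \<Otimes>\<^sub>M borel)" by simp
      have [measurable]: "(\<lambda>z. F (fst z) (snd z)) \<in> borel_measurable (M \<Otimes>\<^sub>M borel)"
        using meas by (simp add: case_prod_unfold)
      show ?thesis by measurable
    qed
    fix z assume "z \<in> space (M \<Otimes>\<^sub>M (borel :: 'a measure))"
    then obtain q x where z: "z = (q, x)" "q \<in> space M" by (auto simp: space_pair_measure)
    have "((\<lambda>s. F q (x + s *\<^sub>R b)) has_derivative (\<lambda>s. (s *\<^sub>R b) \<bullet> grad (F q) x)) (at 0)"
    proof -
      have "((\<lambda>s :: real. x + s *\<^sub>R b) has_derivative (\<lambda>s. s *\<^sub>R b)) (at 0)"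
        by (auto intro!: derivative_eq_intros)
      moreover have "(F q has_derivative (\<lambda>h. h \<bullet> grad (F q) x)) (at (x + 0 *\<^sub>R b))"
        using GDERIV_grad[OF diff[OF z(2)]] by (simp add: gderiv_def)
      ultimately show ?thesis by (rule has_derivative_compose)
    qed
    then have "DERIV (\<lambda>s. F q (x + s *\<^sub>R b)) 0 :> grad (F q) x \<bullet> b"
      unfolding has_field_derivative_def by (rule has_derivative_eq_rhs) (auto simp: inner_commute)
    then have "((\<lambda>s. (F q (x + s *\<^sub>R b) - F q x) / s) \<longlongrightarrow> grad (F q) x \<bullet> b) (at 0)"
      by (simp add: DERIV_def)
    moreover have "filterlim h (at 0) sequentially"
      unfolding h_def using LIMSEQ_inverse_real_of_nat
      by (intro filterlim_atI) (auto simp: inverse_eq_divide)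
    ultimately have "(\<lambda>n. (F q (x + h n *\<^sub>R b) - F q x) / h n) \<longlonglongrightarrow> grad (F q) x \<bullet> b"
      by (rule filterlim_compose)
    then show "(\<lambda>n. (F (fst z) (snd z + h n *\<^sub>R b) - F (fst z) (snd z)) / h n)
        \<longlonglongrightarrow> (case z of (q, x) \<Rightarrow> grad (F q) x) \<bullet> b"
      by (simp add: z)
  qed
qed

text \<open>
  The process is the limit of its values at the grid points \<open>\<lfloor>(n + 1) * t\<rfloor> / (n + 1)\<close>, and for fixed \<open>n\<close>
  there are only countably many of these.\<close>

lemma borel_measurable_continuous_process:
  fixes X :: "real \<Rightarrow> 'q \<Rightarrow> 'a::metric_space"
  assumes meas: "\<And>t. X t \<in> borel_measurable M"
    and cont: "\<And>y. y \<in> space M \<Longrightarrow> continuous_on UNIV (\<lambda>t. X t y)"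
  shows "(\<lambda>(t, y). X t y) \<in> borel_measurable (borel \<Otimes>\<^sub>M M)"
proof (rule borel_measurable_LIMSEQ_metric)
  define k :: "nat \<Rightarrow> real \<Rightarrow> int" where "k n t = \<lfloor>real (Suc n) * t\<rfloor>" for n t
  show "(\<lambda>z. X (of_int (k n (fst z)) / real (Suc n)) (snd z)) \<in> borel_measurable (borel \<Otimes>\<^sub>M M)" for n
  proof (rule measurable_compose_countable[where f = "\<lambda>i z. X (of_int i / real (Suc n)) (snd z)"])
    show "(\<lambda>z. X (of_int i / real (Suc n)) (snd z)) \<in> borel_measurable (borel \<Otimes>\<^sub>M M)" for i
      by (rule measurable_compose[OF measurable_snd meas])
    show "(\<lambda>z. k n (fst z)) \<in> measurable (borel \<Otimes>\<^sub>M M) (count_space UNIV)"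
      unfolding k_def by measurable
  qed
  fix z assume "z \<in> space ((borel :: real measure) \<Otimes>\<^sub>M M)"
  then obtain t y where z: "z = (t, y)" "y \<in> space M" by (auto simp: space_pair_measure)
  have "(\<lambda>n. of_int (k n t) / real (Suc n)) \<longlonglongrightarrow> t"
  proof (rule tendsto_sandwich)
    have "t - 1 / real (Suc n) \<le> of_int (k n t) / real (Suc n) \<and> of_int (k n t) / real (Suc n) \<le> t" for n
    proof -
      define N where "N = real (Suc n)"
      have N: "N > 0" by (simp add: N_def)
      have le: "N * t - 1 \<le> of_int (k n t)" "of_int (k n t) \<le> N * t"
        unfolding k_def N_def by linarith+
      have "(N * t - 1) / N \<le> of_int (k n t) / N" "of_int (k n t) / N \<le> N * t / N"
        by (rule divide_right_mono[OF le(1)], use N in simp, rule divide_right_mono[OF le(2)], use N in simp)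
      then show ?thesis using N unfolding N_def[symmetric] by (simp add: diff_divide_distrib)
    qed
    then show "\<forall>\<^sub>F n in sequentially. t - 1 / real (Suc n) \<le> of_int (k n t) / real (Suc n)"
      "\<forall>\<^sub>F n in sequentially. of_int (k n t) / real (Suc n) \<le> t" by auto
    have "(\<lambda>n. t - 1 / real (Suc n)) \<longlonglongrightarrow> t - 0"
      by (intro tendsto_intros LIMSEQ_Suc[OF lim_1_over_n])
    then show "(\<lambda>n. t - 1 / real (Suc n)) \<longlonglongrightarrow> t" by simp
  qed simp
  then have "(\<lambda>n. X (of_int (k n t) / real (Suc n)) y) \<longlonglongrightarrow> X t y"
    using cont[OF z(2)] by (intro continuous_on_tendsto_compose[OF cont[OF z(2)]]) auto
  then show "(\<lambda>n. X (of_int (k n (fst z)) / real (Suc n)) (snd z)) \<longlonglongrightarrow> (case z of (t, y) \<Rightarrow> X t y)"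
    by (simp add: z)
qed

lemma space_path_borel: "space (path_borel T) = mspace (path_metric T)"
  and sets_path_borel: "sets (path_borel T) =
    sigma_sets (mspace (path_metric T)) {U. openin (mtopology_of (path_metric T)) U}"
proof -
  have "{U. openin (mtopology_of (path_metric T)) U} \<subseteq> Pow (mspace (path_metric T))"
    using openin_subset by fastforce
  then show "space (path_borel T) = mspace (path_metric T)"
    "sets (path_borel T) = sigma_sets (mspace (path_metric T)) {U. openin (mtopology_of (path_metric T)) U}"
    unfolding path_borel_def by (rule space_measure_of, rule sets_measure_of)
qed

text \<open>Evaluation is 1-Lipschitz for the supremum metric.\<close>

lemma path_borel_eval_measurable:
  assumes t: "t \<in> {0..T}"
  shows "(\<lambda>y. y t) \<in> borel_measurable (path_borel T)"
proof (rule borel_measurableI)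
  fix U :: "((real^'n) \<times> real) set" assume "open U"
  interpret Metric_space "mspace (path_metric T)" "mdist (path_metric T :: (real \<Rightarrow> (real^'n) \<times> real) metric)"
    by (rule Metric_space_mspace_mdist)
  have "openin mtopology ((\<lambda>y. y t) -` U \<inter> mspace (path_metric T))"
    unfolding openin_mtopology
  proof (intro conjI allI impI)
    fix y assume y: "y \<in> (\<lambda>y. y t) -` U \<inter> mspace (path_metric T)"
    then obtain r where r: "r > 0" "ball (y t) r \<subseteq> U"
      using \<open>open U\<close> openE by blast
    have "mball y r \<subseteq> (\<lambda>y. y t) -` U \<inter> mspace (path_metric T)"
    proof
      fix w assume w: "w \<in> mball y r"
      then have yw: "y \<in> mspace (path_metric T)" "w \<in> mspace (path_metric T)" "mdist (path_metric T) y w < r"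
        by simp_all
      have "mdist euclidean_metric (y t) (w t) \<le> mdist (path_metric T) y w"
        using mdist_cfunspace_imp_mdist_le[OF yw(1,2)[unfolded path_metric_def] order_refl, of t] t
        by (simp add: path_metric_def)
      then have "w t \<in> ball (y t) r" using yw(3) by simp
      then show "w \<in> (\<lambda>y. y t) -` U \<inter> mspace (path_metric T)" using r(2) yw(2) by auto
    qed
    then show "\<exists>r>0. mball y r \<subseteq> (\<lambda>y. y t) -` U \<inter> mspace (path_metric T)" using r(1) by blast
  qed auto
  then show "(\<lambda>y. y t) -` U \<inter> space (path_borel T) \<in> sets (path_borel T)"
    unfolding space_path_borel sets_path_borel by (intro sigma_sets.Basic) (simp add: mtopology_of_def)
qed

text \<open>
  The data are only controlled for times in \<open>[0, T]\<close>. Composition with this retraction makes them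
  functions of all real times, so that measurability can be stated on the whole space.\<close>

definition clamp_time :: "real \<Rightarrow> real \<Rightarrow> real" where
  "clamp_time T t = max 0 (min T t)"

lemma clamp_time_in: "T > 0 \<Longrightarrow> clamp_time T t \<in> {0..T}"
  and clamp_time_eq [simp]: "t \<in> {0..T} \<Longrightarrow> clamp_time T t = t"
  by (auto simp: clamp_time_def)

lemma clamp_time_cont [continuous_intros]:
  "continuous_on S a \<Longrightarrow> continuous_on S (\<lambda>z. clamp_time T (a z))"
  unfolding clamp_time_def by (intro continuous_intros)

lemma clamp_time_compose_measurable:
  fixes a :: "real \<Rightarrow> 'a::topological_space"
  assumes "T > 0" "continuous_on {0..T} a"
  shows "(\<lambda>t. a (clamp_time T t)) \<in> borel_measurable borel"
proof (rule borel_measurable_continuous_onI)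
  have "continuous_on UNIV (clamp_time T)" by (intro continuous_intros)
  moreover have "clamp_time T ` UNIV \<subseteq> {0..T}" using clamp_time_in[OF assms(1)] by blast
  ultimately show "continuous_on UNIV (\<lambda>t. a (clamp_time T t))"
    by (rule continuous_on_compose2[OF assms(2)])
qed

context mfg_flow
begin

text \<open>As a supremum of continuous functions, the Hamiltonian is lower semicontinuous.\<close>

lemma hamiltonian_measurable:
  "(\<lambda>((t, x), p). H (clamp_time T t) x p) \<in> borel_measurable (borel \<Otimes>\<^sub>M borel)"
proof -
  define F where "F z u = snd z \<bullet> f (clamp_time T (fst (fst z))) (snd (fst z)) (\<mu> (clamp_time T (fst (fst z)))) u
      - g (clamp_time T (fst (fst z))) (snd (fst z)) (\<mu> (clamp_time T (fst (fst z)))) u"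
    for z :: "(real \<times> (real^'n)) \<times> (real^'n)" and u
  have cont: "continuous_on UNIV (\<lambda>z. F z u)" if u: "u \<in> P" for u
  proof -
    define c where "c z = (clamp_time T (fst (fst z)), snd (fst z), u)"
      for z :: "(real \<times> (real^'n)) \<times> (real^'n)"
    have "continuous_on UNIV c" unfolding c_def by (intro continuous_intros)
    moreover have "c ` UNIV \<subseteq> {0..T} \<times> UNIV \<times> P"
      using u clamp_time_in[OF T_pos] by (auto simp: c_def)
    ultimately have "continuous_on UNIV (\<lambda>z. (\<lambda>(t, x, u). f t x (\<mu> t) u) (c z))"
      "continuous_on UNIV (\<lambda>z. (\<lambda>(t, x, u). g t x (\<mu> t) u) (c z))"
      using continuous_on_compose2[OF f_flow_cont] continuous_on_compose2[OF g_flow_cont] by blast+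
    then have "continuous_on UNIV (\<lambda>z. snd z \<bullet> (\<lambda>(t, x, u). f t x (\<mu> t) u) (c z) - (\<lambda>(t, x, u). g t x (\<mu> t) u) (c z))"
      by (intro continuous_on_diff continuous_on_inner continuous_on_snd continuous_on_id)
    then show ?thesis by (simp add: F_def c_def)
  qed
  have eq: "(\<lambda>((t, x), p). H (clamp_time T t) x p) = (\<lambda>z. SUP u\<in>P. F z u)"
    by (auto simp: fun_eq_iff hamiltonian_def F_def)
  have "(\<lambda>z. SUP u\<in>P. F z u) \<in> borel_measurable borel"
  proof (rule borel_measurableI_greater)
    fix c
    have "{z. c < (SUP u\<in>P. F z u)} = (\<Union>u\<in>P. {z. c < F z u})"
    proof -
      have "bdd_above (F z ` P)" for z
        unfolding F_def by (rule bdd_above_prehamiltonian[OF clamp_time_in[OF T_pos]])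
      then show ?thesis using P_compact(2) by (auto simp: less_cSUP_iff)
    qed
    also have "open \<dots>" using cont by (intro open_UN ballI open_Collect_less continuous_on_const)
    finally show "{z \<in> space borel. c < (SUP u\<in>P. F z u)} \<in> sets borel" by simp
  qed
  then show ?thesis unfolding eq borel_prod .
qed

end

context mfg_value
begin

definition velocity :: "real \<Rightarrow> real^'n \<Rightarrow> real^'n" where
  "velocity t x = grad (H t x) (grad (V t) x)"

lemma velocity_measurable: "(\<lambda>(t, x). velocity (clamp_time T t) x) \<in> borel_measurable (borel \<Otimes>\<^sub>M borel)"
proof -
  have "continuous_on UNIV (\<lambda>q. (clamp_time T (fst q), snd q :: real^'n))" by (intro continuous_intros)
  moreover have "(\<lambda>q. (clamp_time T (fst q), snd q)) ` UNIV \<subseteq> {0..T} \<times> (UNIV :: (real^'n) set)"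
    using clamp_time_in[OF T_pos] by auto
  ultimately have "continuous_on UNIV (\<lambda>q. (\<lambda>(t, x). V t x) (clamp_time T (fst q), snd q))"
    using continuous_on_compose2[OF differentiable_imp_continuous_on[OF V_diff]] by blast
  then have "(\<lambda>(t, x). V (clamp_time T t) x) \<in> borel_measurable (borel \<Otimes>\<^sub>M borel)"
    by (simp add: borel_prod case_prod_unfold borel_measurable_continuous_onI)
  then have 1: "(\<lambda>(t, x). grad (V (clamp_time T t)) x) \<in> borel_measurable (borel \<Otimes>\<^sub>M borel)"
  proof (rule borel_measurable_grad)
    fix t x show "V (clamp_time T t) differentiable (at x)"
      using value_derivatives[OF clamp_time_in[OF T_pos], of t x]
      by (metis differentiable_def gderiv_def)
  qed
  have 2: "(\<lambda>((t, x), p). grad (H (clamp_time T t) x) p) \<in> borel_measurable (borel \<Otimes>\<^sub>M borel)"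
    using borel_measurable_grad[where M = "borel :: (real \<times> (real^'n)) measure" and F = "\<lambda>(t, x) p. H (clamp_time T t) x p"]
      hamiltonian_measurable H_diff[OF clamp_time_in[OF T_pos]]
    by (simp add: case_prod_unfold)
  have "(\<lambda>q. (q, (\<lambda>(t, x). grad (V (clamp_time T t)) x) q)) \<in> measurable (borel \<Otimes>\<^sub>M borel) ((borel \<Otimes>\<^sub>M borel) \<Otimes>\<^sub>M borel)"
    using 1 by measurable
  from measurable_compose[OF this 2[folded borel_prod]]
  show ?thesis by (simp add: velocity_def case_prod_unfold)
qed

section \<open>Velocity of trajectories on the graph of the value function\<close>

text \<open>
  At a time of differentiability the velocity \<open>(v, w)\<close> lies in \<open>E\<^sup>-\<close>, so \<open>q \<bullet> v - w \<le> H q\<close> for every \<open>q\<close>.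
  Differentiating \<open>z = V(t, x)\<close> gives \<open>w = a + p \<bullet> v\<close>, where \<open>a\<close> is the time derivative and \<open>p\<close> the spatial
  gradient of \<open>V\<close>; by the Hamilton--Jacobi equation \<open>p \<bullet> v - w = - a = H p\<close>. Hence \<open>v\<close> is the gradient of
  the Hamiltonian at \<open>p\<close>.\<close>

lemma optimal_trajectory_velocity:
  assumes sol: "solves_inclusion 0 T (\<lambda>t (x, z). E_minus P f g t x (\<mu> t)) y"
    and on_graph: "\<And>t. t \<in> {0..T} \<Longrightarrow> snd (y t) = V t (fst (y t))"
  obtains N where "negligible N"
    "\<And>t. t \<in> {0..T} - N \<Longrightarrow>
      ((\<lambda>s. fst (y s)) has_vector_derivative velocity t (fst (y t))) (at t within {0..T})"
proof -
  obtain N y' where N: "negligible N"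
    "\<And>t. t \<in> {0..T} - N \<Longrightarrow> y' t \<in> (case y t of (x, z) \<Rightarrow> E_minus P f g t x (\<mu> t))"
    "\<And>t. t \<in> {0..T} - N \<Longrightarrow> (y has_vector_derivative y' t) (at t within {0..T})"
    using solves_inclusion_derivative[OF sol] by metis
  have "((\<lambda>s. fst (y s)) has_vector_derivative velocity t (fst (y t))) (at t within {0..T})"
    if tN: "t \<in> {0..T} - N" for t
  proof -
    have t: "t \<in> {0..T}" using tN by simp
    define x where "x = fst (y t)"
    define p where "p = grad (V t) x"
    define v where "v = fst (y' t)"
    define w where "w = snd (y' t)"
    have E: "y' t \<in> E_minus P f g t x (\<mu> t)" using N(2)[OF tN] by (simp add: x_def case_prod_unfold)
    have dx: "((\<lambda>s. fst (y s)) has_vector_derivative v) (at t within {0..T})"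
      using bounded_linear.has_vector_derivative[OF bounded_linear_fst N(3)[OF tN]] by (simp add: v_def)
    have dz: "((\<lambda>s. snd (y s)) has_vector_derivative w) (at t within {0..T})"
      using bounded_linear.has_vector_derivative[OF bounded_linear_snd N(3)[OF tN]] by (simp add: w_def)
    obtain a where a: "((\<lambda>(t, x). V t x) has_derivative (\<lambda>(\<tau>, \<xi>). a * \<tau> + p \<bullet> \<xi>)) (at (t, x) within {0..T} \<times> UNIV)"
      unfolding p_def using value_derivatives[OF t] by metis
    have "((\<lambda>s. (s, fst (y s))) has_derivative (\<lambda>\<tau>. (\<tau>, \<tau> *\<^sub>R v))) (at t within {0..T})"
      using dx unfolding has_vector_derivative_def by (intro has_derivative_Pair has_derivative_ident)
    moreover have "((\<lambda>(t, x). V t x) has_derivative (\<lambda>(\<tau>, \<xi>). a * \<tau> + p \<bullet> \<xi>))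
        (at (t, fst (y t)) within (\<lambda>s. (s, fst (y s))) ` {0..T})"
      using has_derivative_subset[OF a, of "(\<lambda>s. (s, fst (y s))) ` {0..T}"] by (auto simp: x_def)
    ultimately have "((\<lambda>s. (\<lambda>(t, x). V t x) (s, fst (y s))) has_derivative
        (\<lambda>\<tau>. (\<lambda>(\<tau>, \<xi>). a * \<tau> + p \<bullet> \<xi>) (\<tau>, \<tau> *\<^sub>R v))) (at t within {0..T})"
      by (rule has_derivative_in_compose)
    then have "((\<lambda>s. V s (fst (y s))) has_vector_derivative (a + p \<bullet> v)) (at t within {0..T})"
      by (simp add: has_vector_derivative_def algebra_simps)
    then have "((\<lambda>s. snd (y s)) has_vector_derivative (a + p \<bullet> v)) (at t within {0..T})"
      by (rule has_vector_derivative_transform[OF t, rotated]) (rule on_graph)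
    then have w: "w = a + p \<bullet> v"
      using vector_derivative_unique_within_closed_interval[OF T_pos, of t] dz t by auto
    have "a + H t x p = 0" by (rule hj_pointwise[OF t a])
    then have "velocity t x = v"
      unfolding velocity_def p_def[symmetric]
      using E_minus_le_hamiltonian[OF t E] w
      by (intro grad_hamiltonian_eqI[OF t, where w = w]) (auto simp: v_def w_def)
    then show ?thesis using dx by (simp add: x_def)
  qed
  then show ?thesis using that N(1) by blast
qed

end

section \<open>The kinetic equation\<close>

lemma norm_grad_bounded_imp_lipschitz:
  fixes \<phi> :: "'a::euclidean_space \<Rightarrow> real"
  assumes "\<And>x. \<phi> differentiable (at x)" and "\<And>x. norm (grad \<phi> x) \<le> K"
  shows "\<bar>\<phi> x - \<phi> y\<bar> \<le> K * norm (x - y)"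
proof -
  have "norm (\<phi> x - \<phi> y) \<le> K * norm (x - y)"
  proof (rule differentiable_bound)
    show "(\<phi> has_derivative (\<lambda>h. h \<bullet> grad \<phi> z)) (at z within UNIV)" for z
      using GDERIV_grad[OF assms(1)[of z]] by (simp add: gderiv_def)
    show "onorm (\<lambda>h. h \<bullet> grad \<phi> z) \<le> K" for z
    proof (rule onorm_le)
      fix h
      have "norm (h \<bullet> grad \<phi> z) \<le> norm h * norm (grad \<phi> z)"
        using Cauchy_Schwarz_ineq2[of h "grad \<phi> z"] by simp
      also have "\<dots> \<le> K * norm h" using mult_right_mono[OF assms(2)[of z] norm_ge_zero[of h]]
          by (simp add: mult.commute)
      finally show "norm (h \<bullet> grad \<phi> z) \<le> K * norm h" .
    qed
  qed auto
  then show ?thesis by simp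
qed

lemma Cb1_boundE:
  assumes "Cb1 \<phi>"
  obtains K where "K \<ge> 0" "\<And>x. \<bar>\<phi> x\<bar> \<le> K" "\<And>x. norm (grad \<phi> x) \<le> K"
proof -
  obtain A B where "\<And>x. norm (\<phi> x) \<le> A" "\<And>x. norm (grad \<phi> x) \<le> B"
    using assms unfolding Cb1_def bounded_iff by auto
  then have "\<bar>\<phi> x\<bar> \<le> \<bar>A\<bar> + \<bar>B\<bar>" "norm (grad \<phi> x) \<le> \<bar>A\<bar> + \<bar>B\<bar>" for x
    by (smt (verit) real_norm_def)+
  then show ?thesis using that[of "\<bar>A\<bar> + \<bar>B\<bar>"] by simp
qed

lemma Cb1_interval_boundE:
  assumes "Cb1_interval T \<psi> \<psi>'"
  obtains K where "K \<ge> 0" "\<And>t. t \<in> {0..T} \<Longrightarrow> \<bar>\<psi> t\<bar> \<le> K" "\<And>t. t \<in> {0..T} \<Longrightarrow> \<bar>\<psi>' t\<bar> \<le> K"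
proof -
  have "bounded (\<psi> ` {0..T})" "bounded (\<psi>' ` {0..T})"
    using assms by (simp_all add: Cb1_interval_def)
  then obtain A B where "\<forall>r\<in>\<psi> ` {0..T}. norm r \<le> A" "\<forall>r\<in>\<psi>' ` {0..T}. norm r \<le> B"
    unfolding bounded_iff by metis
  then have "norm (\<psi> t) \<le> A" "norm (\<psi>' t) \<le> B" if "t \<in> {0..T}" for t
    using that by auto
  then have "\<bar>\<psi> t\<bar> \<le> \<bar>A\<bar> + \<bar>B\<bar>" "\<bar>\<psi>' t\<bar> \<le> \<bar>A\<bar> + \<bar>B\<bar>" if "t \<in> {0..T}" for t
    using that by fastforce+
  then show ?thesis using that[of "\<bar>A\<bar> + \<bar>B\<bar>"] by simp
qed

lemma test_function_along_path_has_integral: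
  fixes x :: "real \<Rightarrow> 'a::euclidean_space"
  assumes ac: "abs_cont_on 0 T x" and "0 \<le> T" and N: "negligible N"
    and dx: "\<And>t. t \<in> {0..T} - N \<Longrightarrow> (x has_vector_derivative v t) (at t within {0..T})"
    and \<phi>: "Cb1 \<phi>" and \<psi>: "Cb1_interval T \<psi> \<psi>'"
  shows "((\<lambda>t. \<psi>' t * \<phi> (x t) + \<psi> t * (v t \<bullet> grad \<phi> (x t))) has_integral
    \<psi> T * \<phi> (x T) - \<psi> 0 * \<phi> (x 0)) {0..T}"
proof (rule abs_cont_on_has_integral[OF _ \<open>0 \<le> T\<close> N])
  obtain K where K: "K \<ge> 0" "\<And>x. \<bar>\<phi> x\<bar> \<le> K" "\<And>x. norm (grad \<phi> x) \<le> K"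
    using Cb1_boundE[OF \<phi>] by metis
  obtain K' where K': "K' \<ge> 0" "\<And>t. t \<in> {0..T} \<Longrightarrow> \<bar>\<psi> t\<bar> \<le> K'" "\<And>t. t \<in> {0..T} \<Longrightarrow> \<bar>\<psi>' t\<bar> \<le> K'"
    using Cb1_interval_boundE[OF \<psi>] by metis
  have d\<psi>: "(\<psi> has_real_derivative \<psi>' t) (at t within {0..T})" if "t \<in> {0..T}" for t
    using \<psi> that by (simp add: Cb1_interval_def)
  show "abs_cont_on 0 T (\<lambda>t. \<psi> t * \<phi> (x t))"
  proof (rule abs_cont_on_compose_dominated[OF ac])
    fix r s assume rs: "0 \<le> r" "r \<le> s" "s \<le> T"
    have "norm (\<psi> s - \<psi> r) \<le> K' * norm (s - r)"
      by (rule field_differentiable_bound[OF convex_real_interval(5)[of 0 T] d\<psi>]) (use K' rs in auto)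
    then have 1: "\<bar>\<psi> s - \<psi> r\<bar> \<le> K' * (s - r)" using rs by simp
    have 2: "\<bar>\<phi> (x s) - \<phi> (x r)\<bar> \<le> K * dist (x r) (x s)"
      using norm_grad_bounded_imp_lipschitz[OF _ K(3), of "x s" "x r"] \<phi>
      by (simp add: Cb1_def dist_norm norm_minus_commute)
    have "\<psi> r * \<phi> (x r) - \<psi> s * \<phi> (x s) = \<psi> r * (\<phi> (x r) - \<phi> (x s)) + (\<psi> r - \<psi> s) * \<phi> (x s)"
      by (simp add: algebra_simps)
    also have "\<bar>\<dots>\<bar> \<le> \<bar>\<psi> r\<bar> * \<bar>\<phi> (x s) - \<phi> (x r)\<bar> + \<bar>\<psi> s - \<psi> r\<bar> * \<bar>\<phi> (x s)\<bar>"
      by (rule order_trans[OF abs_triangle_ineq]) (simp add: abs_mult abs_minus_commute)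
    also have "\<dots> \<le> K' * (K * dist (x r) (x s)) + K' * (s - r) * K"
      using 1 2 K K' rs by (intro add_mono mult_mono) auto
    also have "\<dots> = K * K' * (dist (x r) (x s) + (s - r))" by (simp add: algebra_simps)
    finally show "dist (\<psi> r * \<phi> (x r)) (\<psi> s * \<phi> (x s)) \<le> K * K' * (dist (x r) (x s) + (s - r))"
      by (simp add: dist_real_def)
  qed
  fix t assume t: "t \<in> {0..T} - N"
  have "(\<phi> has_derivative (\<lambda>h. h \<bullet> grad \<phi> (x t))) (at (x t))"
    using \<phi> GDERIV_grad[of \<phi> "x t"] by (simp add: Cb1_def gderiv_def)
  from has_derivative_compose[OF dx[OF t, unfolded has_vector_derivative_def] this]
  have "((\<lambda>t. \<phi> (x t)) has_real_derivative (v t \<bullet> grad \<phi> (x t))) (at t within {0..T})"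
    unfolding has_field_derivative_def by (rule has_derivative_eq_rhs) (auto simp: mult.commute)
  from DERIV_mult[OF d\<psi> this] t
  show "((\<lambda>t. \<psi> t * \<phi> (x t)) has_vector_derivative \<psi>' t * \<phi> (x t) + \<psi> t * (v t \<bullet> grad \<phi> (x t))) (at t within {0..T})"
    by (simp add: has_real_derivative_iff_has_vector_derivative algebra_simps)
qed

text \<open>
  The norm is 1-Lipschitz, so the first moment varies by at most the Wasserstein distance, which is
  bounded on the compact image of \<open>\<mu>\<close>.\<close>

lemma bounded_first_moment:
  fixes \<mu> :: "real \<Rightarrow> ('a::euclidean_space) prob1"
  assumes "continuous_on {0..T} \<mu>"
  obtains R where "R \<ge> 0" "\<And>t. t \<in> {0..T} \<Longrightarrow> integral\<^sup>L (law (\<mu> t)) norm \<le> R"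
proof -
  have "bounded (\<mu> ` {0..T})"
    by (intro compact_imp_bounded compact_continuous_image assms compact_Icc)
  then obtain B where "\<forall>m\<in>\<mu> ` {0..T}. dist (\<mu> 0) m \<le> B"
    unfolding bounded_any_center[where a = "\<mu> 0"] by metis
  then have B: "dist (\<mu> 0) (\<mu> t) \<le> B" if "t \<in> {0..T}" for t using that by simp
  have lip: "1-lipschitz_on UNIV (norm :: 'a \<Rightarrow> real)"
    by (intro lipschitz_onI) (auto simp: dist_norm norm_triangle_ineq3)
  have "integral\<^sup>L (law (\<mu> t)) norm \<le> \<bar>integral\<^sup>L (law (\<mu> 0)) norm\<bar> + \<bar>B\<bar>" if "t \<in> {0..T}" for t
    using wdist_upper[OF lip, of "\<mu> t" "\<mu> 0"] B[OF that] wdist_commute[of "\<mu> t" "\<mu> 0"]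
    by (simp add: dist_prob1_def)
  then show ?thesis using that[of "\<bar>integral\<^sup>L (law (\<mu> 0)) norm\<bar> + \<bar>B\<bar>"] by simp
qed

context mfg_value
begin

text \<open>
  Along each trajectory \<open>x\<close> of the solution set on which the path measure lives, the integral over \<open>[0, T]\<close> of the derivative of
  \<open>\<psi>(t) \<phi>(x(t))\<close> vanishes, because \<open>\<psi>\<close> vanishes at both ends. Averaging over the path
  measure and exchanging the integrals gives the weak equation. The exchange is justified by the linear
  growth of the velocity together with the bound on the first moments of \<open>\<mu> t\<close>.\<close>

lemma kinetic_equation:
  assumes Q: "prob_space Q" "sets Q = sets (restrict_space (path_borel T) (sol_set T P f g V \<mu>))"
    and law: "\<And>t. t \<in> {0..T} \<Longrightarrow> law (\<mu> t) = distr Q borel (\<lambda>y. fst (y t))"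
  shows "kinetic_weak_solution T velocity \<mu>"
  unfolding kinetic_weak_solution_def
proof (intro allI impI)
  fix \<phi> :: "real^'n \<Rightarrow> real" and \<psi> \<psi>' :: "real \<Rightarrow> real"
  assume \<phi>: "Cb1 \<phi>" and \<psi>: "Cb1_interval T \<psi> \<psi>'" and \<psi>0: "\<psi> 0 = 0" "\<psi> T = 0"
  let ?c = "clamp_time T"
  have c: "?c t \<in> {0..T}" for t by (rule clamp_time_in[OF T_pos])
  interpret prob_space Q by (rule Q(1))
  interpret pair_sigma_finite lborel Q ..
  have spQ: "y \<in> sol_set T P f g V \<mu>" if "y \<in> space Q" for y
    using that sets_eq_imp_space_eq[OF Q(2)] by (auto simp: space_restrict_space)
  have ac: "abs_cont_on 0 T (\<lambda>t. fst (y t))" if "y \<in> space Q" for y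
  proof -
    have "abs_cont_on 0 T y" using spQ[OF that] by (simp add: sol_set_def solves_inclusion_def)
    then show ?thesis
      by (rule abs_cont_on_compose_dominated[where K = 1]) (simp add: dist_fst_le add_increasing2)
  qed
  define X where "X t y = fst (y (?c t))" for t and y :: "real \<Rightarrow> (real^'n) \<times> real"
  have Xt: "X t \<in> borel_measurable Q" for t
  proof -
    have "(\<lambda>y. y (?c t)) \<in> borel_measurable (restrict_space (path_borel T) (sol_set T P f g V \<mu>))"
      by (intro measurable_restrict_space1 path_borel_eval_measurable c)
    then have "(\<lambda>y. y (?c t)) \<in> borel_measurable Q" by (simp add: measurable_cong_sets[OF Q(2) refl])
    then show ?thesis unfolding X_def
      by (rule measurable_compose) (intro borel_measurable_continuous_onI continuous_intros)
  qed
  have "(\<lambda>(t, y). X t y) \<in> borel_measurable (borel \<Otimes>\<^sub>M Q)"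
  proof (rule borel_measurable_continuous_process[OF Xt])
    fix y assume "y \<in> space Q"
    then show "continuous_on UNIV (\<lambda>t. X t y)"
      unfolding X_def using c
      by (intro continuous_on_compose2[OF abs_cont_on_imp_continuous_on[OF ac]] continuous_intros) auto
  qed
  then have X[measurable]: "(\<lambda>z. X (fst z) (snd z)) \<in> borel_measurable (borel \<Otimes>\<^sub>M Q)"
    by (simp add: case_prod_unfold)
  have law_X: "(\<integral>x. h x \<partial>law (\<mu> t)) = (\<integral>y. h (X t y) \<partial>Q)"
      "integrable (law (\<mu> t)) h \<longleftrightarrow> integrable Q (\<lambda>y. h (X t y))"
    if "t \<in> {0..T}" "h \<in> borel_measurable borel" for t and h :: "real^'n \<Rightarrow> real"
  proof -
    have "X t = (\<lambda>y. fst (y t))" using that(1) by (simp add: X_def fun_eq_iff)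
    then have "law (\<mu> t) = distr Q borel (X t)" using law[OF that(1)] by simp
    then show "(\<integral>x. h x \<partial>law (\<mu> t)) = (\<integral>y. h (X t y) \<partial>Q)"
      "integrable (law (\<mu> t)) h \<longleftrightarrow> integrable Q (\<lambda>y. h (X t y))"
      using integral_distr[OF Xt that(2)] integrable_distr_eq[OF Xt that(2)] by simp_all
  qed

  obtain K where K: "K \<ge> 0" "\<And>x. \<bar>\<phi> x\<bar> \<le> K" "\<And>x. norm (grad \<phi> x) \<le> K"
    using Cb1_boundE[OF \<phi>] by metis
  obtain K' where K': "K' \<ge> 0" "\<And>t. t \<in> {0..T} \<Longrightarrow> \<bar>\<psi> t\<bar> \<le> K'" "\<And>t. t \<in> {0..T} \<Longrightarrow> \<bar>\<psi>' t\<bar> \<le> K'"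
    using Cb1_interval_boundE[OF \<psi>] by metis
  obtain C where C: "C \<ge> 0" "\<And>t x. t \<in> {0..T} \<Longrightarrow> norm (velocity t x) \<le> C + \<bar>L\<bar> * norm x"
    unfolding velocity_def using grad_hamiltonian_growth by metis
  obtain R where R: "R \<ge> 0" "\<And>t. t \<in> {0..T} \<Longrightarrow> integral\<^sup>L (law (\<mu> t)) norm \<le> R"
    using bounded_first_moment[OF \<mu>_cont] by metis

  \<comment> \<open>The two integrands of the weak equation, with time clamped, and a common dominating function \<open>w\<close>.\<close>
  define \<alpha> where "\<alpha> t x = \<psi>' (?c t) * \<phi> x" for t x
  define \<beta> where "\<beta> t x = \<psi> (?c t) * (velocity (?c t) x \<bullet> grad \<phi> x)" for t x
  have [measurable]: "\<phi> \<in> borel_measurable borel"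
    using \<phi> by (intro borel_measurable_continuous_onI differentiable_imp_continuous_on)
      (auto simp: Cb1_def differentiable_on_def differentiable_at_withinI)
  have [measurable]: "grad \<phi> \<in> borel_measurable borel"
    using \<phi> by (intro borel_measurable_continuous_onI) (simp add: Cb1_def)
  have "continuous_on {0..T} \<psi>" "continuous_on {0..T} \<psi>'"
    using \<psi> DERIV_continuous unfolding Cb1_interval_def continuous_on_eq_continuous_within by blast+
  then have [measurable]: "(\<lambda>t. \<psi> (?c t)) \<in> borel_measurable borel" "(\<lambda>t. \<psi>' (?c t)) \<in> borel_measurable borel"
    using clamp_time_compose_measurable[OF T_pos] by blast+
  have [measurable]: "(\<lambda>q. velocity (?c (fst q)) (snd q)) \<in> borel_measurable (borel \<Otimes>\<^sub>M borel)"
    using velocity_measurable by (simp add: case_prod_unfold)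
  have \<alpha>_meas: "(\<lambda>q. \<alpha> (fst q) (snd q)) \<in> borel_measurable (borel \<Otimes>\<^sub>M borel)" unfolding \<alpha>_def by measurable
  have \<beta>_meas: "(\<lambda>q. \<beta> (fst q) (snd q)) \<in> borel_measurable (borel \<Otimes>\<^sub>M borel)" unfolding \<beta>_def by measurable

  define w where "w x = K' * K * (1 + C + \<bar>L\<bar> * norm x)" for x :: "real^'n"
  have w_meas [measurable]: "w \<in> borel_measurable borel" unfolding w_def by measurable
  have w_nonneg: "w x \<ge> 0" for x using K(1) K'(1) C(1) by (simp add: w_def)
  have \<alpha>_le: "\<bar>\<alpha> t x\<bar> \<le> w x" for t x
  proof -
    have "\<bar>\<alpha> t x\<bar> \<le> K' * K"
      unfolding \<alpha>_def abs_mult using K K' c by (intro mult_mono) auto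
    also have "\<dots> \<le> w x"
      using mult_left_mono[of 1 "1 + C + \<bar>L\<bar> * norm x" "K' * K"] K(1) K'(1) C(1) by (simp add: w_def)
    finally show ?thesis .
  qed
  have \<beta>_le: "\<bar>\<beta> t x\<bar> \<le> w x" for t x
  proof -
    have "\<bar>velocity (?c t) x \<bullet> grad \<phi> x\<bar> \<le> (C + \<bar>L\<bar> * norm x) * K"
      using C(2)[OF c] K C(1) by (intro order_trans[OF Cauchy_Schwarz_ineq2] mult_mono) auto
    then have "\<bar>\<beta> t x\<bar> \<le> K' * ((C + \<bar>L\<bar> * norm x) * K)"
      unfolding \<beta>_def abs_mult using K' c by (intro mult_mono) auto
    also have "\<dots> \<le> w x" using K(1) K'(1) by (simp add: w_def algebra_simps)
    finally show ?thesis .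
  qed
  have law_w: "integrable (law (\<mu> t)) w" "integral\<^sup>L (law (\<mu> t)) w \<le> K' * K * (1 + C + \<bar>L\<bar> * R)"
    if "t \<in> {0..T}" for t
  proof -
    interpret \<mu>t: prob_space "law (\<mu> t)" by (rule prob_space_law)
    show "integrable (law (\<mu> t)) w" unfolding w_def using integrable_norm_law[of "\<mu> t"] by auto
    have "integral\<^sup>L (law (\<mu> t)) w = K' * K * (1 + C + \<bar>L\<bar> * integral\<^sup>L (law (\<mu> t)) norm)"
      unfolding w_def using integrable_norm_law[of "\<mu> t"] \<mu>t.prob_space by simp
    also have "\<dots> \<le> K' * K * (1 + C + \<bar>L\<bar> * R)"
      using K(1) K'(1) R(2)[OF that] by (intro mult_left_mono add_left_mono) auto
    finally show "integral\<^sup>L (law (\<mu> t)) w \<le> K' * K * (1 + C + \<bar>L\<bar> * R)" .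
  qed

  have int_w: "integrable (lborel \<Otimes>\<^sub>M Q) (\<lambda>z. indicator {0..T} (fst z) * w (X (fst z) (snd z)))"
  proof (rule Fubini_integrable)
    show "(\<lambda>z. indicator {0..T} (fst z) * w (X (fst z) (snd z))) \<in> borel_measurable (lborel \<Otimes>\<^sub>M Q)"
      by measurable
    have "integrable lborel (\<lambda>t. indicator {0..T} t * (\<integral>y. w (X t y) \<partial>Q))"
    proof (rule Bochner_Integration.integrable_bound)
      show "integrable lborel (\<lambda>t. indicator {0..T} t * (K' * K * (1 + C + \<bar>L\<bar> * R)))"
        using T_pos by (intro integrable_mult_left integrable_real_indicator) auto
      show "(\<lambda>t. indicator {0..T} t * (\<integral>y. w (X t y) \<partial>Q)) \<in> borel_measurable lborel"
        by measurable
      have "0 \<le> (\<integral>y. w (X t y) \<partial>Q)" for t using w_nonneg by (intro integral_nonneg_AE) auto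
      then show "AE t in lborel. norm (indicator {0..T} t * (\<integral>y. w (X t y) \<partial>Q))
          \<le> norm (indicator {0..T} t * (K' * K * (1 + C + \<bar>L\<bar> * R)))"
        using law_w(2) law_X(1)[OF _ w_meas] by (intro AE_I2) (fastforce simp: indicator_def)
    qed
    then show "integrable lborel (\<lambda>t. \<integral>y. norm (indicator {0..T} (fst (t, y)) * w (X (fst (t, y)) (snd (t, y)))) \<partial>Q)"
      using w_nonneg by (simp add: abs_mult)
    show "AE t in lborel. integrable Q (\<lambda>y. indicator {0..T} (fst (t, y)) * w (X (fst (t, y)) (snd (t, y))))"
      using law_X(2)[OF _ w_meas] law_w(1) by (intro AE_I2) (auto simp: indicator_def)
  qed
  have int_pair: "integrable (lborel \<Otimes>\<^sub>M Q) (\<lambda>(t, y). indicator {0..T} t * h t (X t y))"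
    if h: "(\<lambda>q. h (fst q) (snd q)) \<in> borel_measurable (borel \<Otimes>\<^sub>M borel)" "\<And>t x. \<bar>h t x\<bar> \<le> w x"
    for h :: "real \<Rightarrow> real^'n \<Rightarrow> real"
  proof (rule Bochner_Integration.integrable_bound[OF int_w])
    have "(\<lambda>z. (fst z, X (fst z) (snd z))) \<in> measurable (lborel \<Otimes>\<^sub>M Q) (borel \<Otimes>\<^sub>M borel)" by measurable
    from measurable_compose[OF this h(1)]
    have [measurable]: "(\<lambda>z. h (fst z) (X (fst z) (snd z))) \<in> borel_measurable (lborel \<Otimes>\<^sub>M Q)" by simp
    show "(\<lambda>(t, y). indicator {0..T} t * h t (X t y)) \<in> borel_measurable (lborel \<Otimes>\<^sub>M Q)"
      unfolding case_prod_unfold by measurable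
    show "AE z in lborel \<Otimes>\<^sub>M Q. norm (case z of (t, y) \<Rightarrow> indicator {0..T} t * h t (X t y))
        \<le> norm (indicator {0..T} (fst z) * w (X (fst z) (snd z)))"
      using h(2) by (intro AE_I2) (auto simp: indicator_def split_beta intro: order_trans[OF _ abs_ge_self])
  qed
  note int_\<alpha> = int_pair[OF \<alpha>_meas \<alpha>_le] and int_\<beta> = int_pair[OF \<beta>_meas \<beta>_le]
  have law_h: "(\<integral>y. indicator {0..T} t * h t (X t y) \<partial>Q) = indicator {0..T} t * (\<integral>x. h t x \<partial>law (\<mu> t))"
    if h: "(\<lambda>q. h (fst q) (snd q)) \<in> borel_measurable (borel \<Otimes>\<^sub>M borel)" for h :: "real \<Rightarrow> real^'n \<Rightarrow> real" and t
  proof -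
    have "(\<lambda>x. (t, x)) \<in> measurable borel (borel \<Otimes>\<^sub>M borel)" by measurable
    from measurable_compose[OF this h] have "h t \<in> borel_measurable borel" by simp
    then show ?thesis using law_X(1)[of t "h t"] by (cases "t \<in> {0..T}") auto
  qed

  have "(\<integral>t. \<integral>y. indicator {0..T} t * \<alpha> t (X t y) \<partial>Q \<partial>lborel) + (\<integral>t. \<integral>y. indicator {0..T} t * \<beta> t (X t y) \<partial>Q \<partial>lborel)
      = (\<integral>y. \<integral>t. indicator {0..T} t * \<alpha> t (X t y) \<partial>lborel \<partial>Q) + (\<integral>y. \<integral>t. indicator {0..T} t * \<beta> t (X t y) \<partial>lborel \<partial>Q)"
    using Fubini_integral[OF int_\<alpha>] Fubini_integral[OF int_\<beta>] by simp
  also have "\<dots> = (\<integral>y. (\<integral>t. indicator {0..T} t * \<alpha> t (X t y) \<partial>lborel) + (\<integral>t. indicator {0..T} t * \<beta> t (X t y) \<partial>lborel) \<partial>Q)"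
    using integrable_snd[OF int_\<alpha>] integrable_snd[OF int_\<beta>] by simp
  also have "\<dots> = (\<integral>y. 0 \<partial>Q)"
  proof (rule integral_cong_AE)
    show "(\<lambda>y. (\<integral>t. indicator {0..T} t * \<alpha> t (X t y) \<partial>lborel) + (\<integral>t. indicator {0..T} t * \<beta> t (X t y) \<partial>lborel)) \<in> borel_measurable Q"
      using integrable_snd[OF int_\<alpha>] integrable_snd[OF int_\<beta>] by measurable
    have zero: "(\<integral>t. indicator {0..T} t * \<alpha> t (X t y) \<partial>lborel) + (\<integral>t. indicator {0..T} t * \<beta> t (X t y) \<partial>lborel) = 0"
      if y: "y \<in> space Q" and int: "integrable lborel (\<lambda>t. indicator {0..T} t * \<alpha> t (X t y))"
        "integrable lborel (\<lambda>t. indicator {0..T} t * \<beta> t (X t y))" for y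
    proof -
      obtain N where N: "negligible N" "\<And>t. t \<in> {0..T} - N \<Longrightarrow>
          ((\<lambda>s. fst (y s)) has_vector_derivative velocity t (fst (y t))) (at t within {0..T})"
        using optimal_trajectory_velocity[of y] spQ[OF y] by (auto simp: sol_set_def)
      have "((\<lambda>t. \<psi>' t * \<phi> (fst (y t)) + \<psi> t * (velocity t (fst (y t)) \<bullet> grad \<phi> (fst (y t)))) has_integral 0) {0..T}"
        using test_function_along_path_has_integral[OF ac[OF y] _ N \<phi> \<psi>] T_pos \<psi>0 by simp
      then have "((\<lambda>t. \<alpha> t (X t y) + \<beta> t (X t y)) has_integral 0) {0..T}"
        by (rule has_integral_eq[rotated]) (simp add: \<alpha>_def \<beta>_def X_def)
      then have i1: "((\<lambda>t. if t \<in> {0..T} then \<alpha> t (X t y) + \<beta> t (X t y) else 0) has_integral 0) UNIV"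
        by (simp only: has_integral_restrict_UNIV)
      have eq: "(\<lambda>t. if t \<in> {0..T} then \<alpha> t (X t y) + \<beta> t (X t y) else 0) =
          (\<lambda>t. indicator {0..T} t * \<alpha> t (X t y) + indicator {0..T} t * \<beta> t (X t y))"
        by (auto simp: fun_eq_iff indicator_def)
      have i2: "((\<lambda>t. indicator {0..T} t * \<alpha> t (X t y) + indicator {0..T} t * \<beta> t (X t y)) has_integral
          (\<integral>t. indicator {0..T} t * \<alpha> t (X t y) \<partial>lborel) + (\<integral>t. indicator {0..T} t * \<beta> t (X t y) \<partial>lborel)) UNIV"
        by (intro has_integral_add has_integral_integral_lborel int)
      show ?thesis by (rule has_integral_unique[OF i2 i1[unfolded eq]])
    qed
    show "AE y in Q. (\<integral>t. indicator {0..T} t * \<alpha> t (X t y) \<partial>lborel) + (\<integral>t. indicator {0..T} t * \<beta> t (X t y) \<partial>lborel) = 0"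
      using AE_integrable_snd[OF int_\<alpha>] AE_integrable_snd[OF int_\<beta>] AE_space
    proof eventually_elim
      case (elim y)
      then show ?case by (intro zero)
    qed
  qed simp
  finally have total: "(\<integral>t. indicator {0..T} t * (\<integral>x. \<alpha> t x \<partial>law (\<mu> t)) \<partial>lborel)
      + (\<integral>t. indicator {0..T} t * (\<integral>x. \<beta> t x \<partial>law (\<mu> t)) \<partial>lborel) = 0"
    by (simp only: law_h[OF \<alpha>_meas] law_h[OF \<beta>_meas] Bochner_Integration.integral_zero)

  have restrict: "(LBINT t:{0..T}. a t) = (\<integral>t. indicator {0..T} t * b t \<partial>lborel)"
    if "\<And>t. t \<in> {0..T} \<Longrightarrow> a t = b t" for a b :: "real \<Rightarrow> real"
    unfolding set_lebesgue_integral_def using that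
    by (intro Bochner_Integration.integral_cong) (auto simp: indicator_def)
  show "(\<forall>t\<in>{0..T}. integrable (law (\<mu> t)) (\<lambda>x. \<psi> t * (velocity t x \<bullet> grad \<phi> x))) \<and>
        set_integrable lborel {0..T} (\<lambda>t. \<integral>x. \<psi> t * (velocity t x \<bullet> grad \<phi> x) \<partial>law (\<mu> t)) \<and>
        - (LBINT t:{0..T}. (\<integral>x. \<psi>' t * \<phi> x \<partial>law (\<mu> t))) =
          (LBINT t:{0..T}. (\<integral>x. \<psi> t * (velocity t x \<bullet> grad \<phi> x) \<partial>law (\<mu> t)))"
  proof (intro conjI ballI)
    fix t assume t: "t \<in> {0..T}"
    have "(\<lambda>x. (t, x)) \<in> measurable borel (borel \<Otimes>\<^sub>M borel)" by measurable
    from measurable_compose[OF this \<beta>_meas] have "\<beta> t \<in> borel_measurable borel" by simp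
    then have "integrable (law (\<mu> t)) (\<beta> t)"
      using \<beta>_le by (intro Bochner_Integration.integrable_bound[OF law_w(1)[OF t]] AE_I2)
        (auto simp: measurable_cong_sets[OF sets_law refl] intro: order_trans[OF _ abs_ge_self])
    then show "integrable (law (\<mu> t)) (\<lambda>x. \<psi> t * (velocity t x \<bullet> grad \<phi> x))"
      using t by (simp add: \<beta>_def[abs_def])
  next
    have "integrable lborel (\<lambda>t. indicator {0..T} t * (\<integral>x. \<beta> t x \<partial>law (\<mu> t)))"
      using integrable_fst[OF int_\<beta>] by (simp only: law_h[OF \<beta>_meas])
    then show "set_integrable lborel {0..T} (\<lambda>t. \<integral>x. \<psi> t * (velocity t x \<bullet> grad \<phi> x) \<partial>law (\<mu> t))"
      unfolding set_integrable_def
      by (rule Bochner_Integration.integrable_cong[OF refl, THEN iffD1, rotated]) (auto simp: indicator_def \<beta>_def)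
  next
    have "(LBINT t:{0..T}. (\<integral>x. \<psi>' t * \<phi> x \<partial>law (\<mu> t))) = (\<integral>t. indicator {0..T} t * (\<integral>x. \<alpha> t x \<partial>law (\<mu> t)) \<partial>lborel)"
      "(LBINT t:{0..T}. (\<integral>x. \<psi> t * (velocity t x \<bullet> grad \<phi> x) \<partial>law (\<mu> t))) = (\<integral>t. indicator {0..T} t * (\<integral>x. \<beta> t x \<partial>law (\<mu> t)) \<partial>lborel)"
      by (intro restrict; simp add: \<alpha>_def \<beta>_def)+
    then show "- (LBINT t:{0..T}. (\<integral>x. \<psi>' t * \<phi> x \<partial>law (\<mu> t))) =
          (LBINT t:{0..T}. (\<integral>x. \<psi> t * (velocity t x \<bullet> grad \<phi> x) \<partial>law (\<mu> t)))"
      using total by linarith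
  qed
qed

end

section \<open>Minimax solutions with a differentiable value function\<close>

theorem proposition2:
  fixes T :: real
    and P :: "'u::metric_space set"
    and f :: "real \<Rightarrow> real^'n::finite \<Rightarrow> (real^'n) prob1 \<Rightarrow> 'u \<Rightarrow> real^'n"
    and g :: "real \<Rightarrow> real^'n \<Rightarrow> (real^'n) prob1 \<Rightarrow> 'u \<Rightarrow> real"
    and \<sigma> :: "real^'n \<Rightarrow> (real^'n) prob1 \<Rightarrow> real"
    and m\<^sub>0 :: "(real^'n) prob1"
    and L\<^sub>x L\<^sub>m :: real
    and V :: "real \<Rightarrow> real^'n \<Rightarrow> real"
    and \<mu> :: "real \<Rightarrow> (real^'n) prob1"
  assumes T_pos: "T > 0"
    and P_compact: "compact P" "P \<noteq> {}"
    and f_cont: "continuous_on ({0..T} \<times> UNIV \<times> UNIV \<times> P) (\<lambda>(t, x, m, u). f t x m u)"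
    and g_cont: "continuous_on ({0..T} \<times> UNIV \<times> UNIV \<times> P) (\<lambda>(t, x, m, u). g t x m u)"
    and f_lipschitz_x: "\<And>t x' x'' m u. t \<in> {0..T} \<Longrightarrow> u \<in> P \<Longrightarrow>
          norm (f t x' m u - f t x'' m u) \<le> L\<^sub>x * norm (x' - x'')"
    and f_lipschitz_m: "\<And>t x m' m'' u. t \<in> {0..T} \<Longrightarrow> u \<in> P \<Longrightarrow>
          norm (f t x m' u - f t x m'' u) \<le> L\<^sub>m * dist m' m''"
    and \<sigma>_cont: "continuous_on UNIV (\<lambda>(x, m). \<sigma> x m)"
    and m\<^sub>0_support: "compact (msupport (law m\<^sub>0))"
    and invariant_compact: "\<exists>G. compact G \<and>
          (\<forall>\<nu> u x. continuous_on {0..T} \<nu> \<longrightarrow>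
             u \<in> borel_measurable (lebesgue_on {0..T}) \<longrightarrow> u ` {0..T} \<subseteq> P \<longrightarrow>
             solves_inclusion 0 T (\<lambda>t x. {f t x (\<nu> t) (u t)}) x \<longrightarrow> x 0 \<in> msupport (law m\<^sub>0) \<longrightarrow>
             (\<forall>t\<in>{0..T}. x t \<in> G))"
    and solution: "mfg_minimax_solution T P f g \<sigma> m\<^sub>0 V \<mu>"
    and H_differentiable: "\<And>t x m p. t \<in> {0..T} \<Longrightarrow>
          hamiltonian P f g t x m differentiable (at p)"
    and V_differentiable: "(\<lambda>(t, x). V t x) differentiable_on {0..T} \<times> UNIV"
  shows "hj_classical_solution T P f g \<sigma> \<mu> V \<and>
         kinetic_weak_solution T
           (\<lambda>t x. grad (hamiltonian P f g t x (\<mu> t)) (grad (V t) x)) \<mu> \<and>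
         \<mu> 0 = m\<^sub>0"
proof -
  have \<mu>_cont: "continuous_on {0..T} \<mu>"
    and hj: "hj_minimax_solution T P f g \<sigma> \<mu> V"
    and init: "\<mu> 0 = m\<^sub>0"
    using solution by (simp_all add: mfg_minimax_solution_def)
  obtain Q where Q: "prob_space Q" "sets Q = sets (restrict_space (path_borel T) (sol_set T P f g V \<mu>))"
    "\<forall>t\<in>{0..T}. law (\<mu> t) = distr Q borel (\<lambda>y. fst (y t))"
    using solution unfolding mfg_minimax_solution_def by blast
  interpret mfg_value T P f g \<mu> L\<^sub>x V
  proof
    show "viable T (epi T V) (\<lambda>t (x, z). E_plus f g t x (\<mu> t) u)" if "u \<in> P" for u
      using hj that by (simp add: hj_minimax_solution_def)
    show "viable T (hypo T V) (\<lambda>t (x, z). E_minus P f g t x (\<mu> t))"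
      using hj by (simp add: hj_minimax_solution_def)
  qed (fact T_pos P_compact f_cont g_cont f_lipschitz_x \<mu>_cont H_differentiable V_differentiable)+
  have "hj_classical_solution T P f g \<sigma> \<mu> V"
    unfolding hj_classical_solution_def
  proof (intro conjI ballI allI)
    fix t x assume t: "t \<in> {0..T}"
    obtain a where a:
      "((\<lambda>(t, x). V t x) has_derivative (\<lambda>(\<tau>, \<xi>). a * \<tau> + grad (V t) x \<bullet> \<xi>)) (at (t, x) within {0..T} \<times> UNIV)"
      "GDERIV (V t) x :> grad (V t) x" "((\<lambda>s. V s x) has_real_derivative a) (at t within {0..T})"
      using value_derivatives[OF t] .
    then show "\<exists>V\<^sub>t p. ((\<lambda>s. V s x) has_real_derivative V\<^sub>t) (at t within {0..T}) \<and>
        (GDERIV (V t) x :> p) \<and> V\<^sub>t + hamiltonian P f g t x (\<mu> t) p = 0"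
      using hj_pointwise[OF t a(1)] by blast
  next
    show "V T x = \<sigma> x (\<mu> T)" for x
      using hj by (simp add: hj_minimax_solution_def)
  qed
  moreover have "velocity = (\<lambda>t x. grad (hamiltonian P f g t x (\<mu> t)) (grad (V t) x))"
    by (simp add: velocity_def fun_eq_iff)
  ultimately show ?thesis
    using kinetic_equation[OF Q(1,2)] Q(3) init by simp
qed

end
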